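(* Let $\mathcal{K}$ be a field, $\Gamma\leq\mathbb{R}$ an additive subgroup, $\Lambda=\Lambda^{\mathcal{K},\Gamma}$, let $(C_*,\partial,\ell)$ be a Floer-type complex over $\Lambda$, let $k\in\mathbb{Z}$, and let $\mathcal{B}_{C,k}$ denote the degree-$k$ part of its concise barcode, obtained from a singular value decomposition of $\partial_{k+1}\colon C_{k+1}\to\ker\partial_k$. Then there is a basis $\{\alpha_1,\dots,\alpha_h\}$ for $H_k(C_* )$ over $\Lambda$ such that: (i) The submultiset of $\mathcal{B}_{C,k}$ consisting of elements with second coordinate equal to $\infty$ is equal to $\{([\rho(\alpha_1)],\infty),\dots,([\rho(\alpha_h)],\infty)\}$, where $[\rho(\alpha_i)]$ denotes the reduction of $\rho(\alpha_i)$ modulo $\Gamma$. (ii) For any class $\alpha\in H_k(C_* )$, if we write $\alpha=\sum_{i=1}^h\lambda_i\alpha_i$ with $\lambda_i\in\Lambda$, then $\rho(\alpha)=\max_i(\rho(\alpha_i)-\nu(\lambda_i))$. In particular, if $\alpha\neq 0$, then $\mathcal{B}_{C,k}$ contains an element of the form $([\rho(\alpha)],\infty)$.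
   Context: **Novikov field.** $\Lambda=\Lambda^{\mathcal{K},\Gamma}$ is the field of formal sums $\sum_{g\in\Gamma}a_gT^g$ with $a_g\in\mathcal{K}$ such that for every $C\in\mathbb{R}$ only finitely many $g<C$ have $a_g\neq 0$, with power-series addition and multiplication. Its valuation is $\nu(\sum a_gT^g)=\min\{g\mid a_g\neq 0\}$, $\nu(0)=\infty$. **Orthogonalizable spaces.** A non-Archimedean normed vector space over $\Lambda$ is a pair $(C,\ell)$ with $C$ a $\Lambda$-vector space and $\ell\colon C\to\mathbb{R}\cup\{-\infty\}$ satisfying: $\ell(x)=-\infty$ iff $x=0$; $\ell(\lambda x)=\ell(x)-\nu(\lambda)$; $\ell(x+y)\leq\max\{\ell(x),\ell(y)\}$. A finite ordered collection $(w_1,\dots,w_r)$ in $C$ is orthogonal if $\ell(\sum_i\lambda_iw_i)=\max_i\ell(\lambda_iw_i)$ for all $\lambda_i\in\Lambda$. An orthogonalizable $\Lambda$-space is a finite-dimensional non-Archimedean normed vector space admitting an orthogonal basis; subspaces (with restricted $\ell$) are again orthogonalizable. **Singular value decomposition.** Let $A\colon C\to D$ be a $\Lambda$-linear map of rank $r$ between orthogonalizable $\Lambda$-spaces. A singular value decomposition of $A$ is a choice of orthogonal ordered bases $(y_1,\dots,y_n)$ for $C$ and $(x_1,\dots,x_m)$ for $D$ such that: $(y_{r+1},\dots,y_n)$ is an orthogonal ordered basis for $\ker A$; $(x_1,\dots,x_r)$ is an orthogonal ordered basis for $\mathrm{Im}\,A$; $Ay_i=x_i$ for $i\leq r$; $\ell_C(y_1)-\ell_D(x_1)\geq\cdots\geq\ell_C(y_r)-\ell_D(x_r)$.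 **Floer-type complex.** $(C_*,\partial,\ell)$ is a chain complex $C_*=\bigoplus_{k\in\mathbb{Z}}C_k$ of $\Lambda$-vector spaces ($\partial C_k\subset C_{k-1}$, $\partial_k=\partial|_{C_k}$) with a function $\ell$ such that each $(C_k,\ell|_{C_k})$ is orthogonalizable and $\ell(\partial x)\leq\ell(x)$ for $x\in C_k$. **Concise barcode.** From a singular value decomposition $((y_1,\dots,y_n),(x_1,\dots,x_m))$ of $\partial_{k+1}\colon C_{k+1}\to\ker\partial_k$, with $r=\mathrm{rank}\,\partial_{k+1}$, the degree-$k$ concise barcode is the multiset of elements of $(\mathbb{R}/\Gamma)\times(0,\infty]$ consisting of $(\ell(x_i)\bmod\Gamma,\ell(y_i)-\ell(x_i))$ for those $i\leq r$ with $\ell(y_i)>\ell(x_i)$, and $(\ell(x_i)\bmod\Gamma,\infty)$ for $i=r+1,\dots,m$. It does not depend on the choice of singular value decomposition. **Spectral invariants.** $\rho\colon H_k(C_* )\to\mathbb{R}\cup\{-\infty\}$ is defined by $\rho(\alpha)=\inf\{\ell(c)\mid c\in C_k,\ \partial c=0,\ [c]=\alpha\}$. *)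

theory Defs
  imports "HOL-Algebra.AbelCoset" "Jordan_Normal_Form.Missing_VectorSpace" "HOL-Library.Extended_Real"
begin

text \<open>The groups of exponents are the subgroups of the additive group of the reals.\<close>

definition real_add_group :: "real monoid" where
  "real_add_group = \<lparr>carrier = UNIV, mult = (+), one = 0\<rparr>"

section \<open>The Novikov field\<close>

text \<open>
  A formal sum \<open>\<Sum> a\<^sub>g T\<^sup>g\<close> is the function \<open>g \<mapsto> a\<^sub>g\<close> on all reals, extended by zero outside
  \<open>\<Gamma>\<close>.
\<close>

definition novikov_carrier :: "('k, 'm) ring_scheme \<Rightarrow> real set \<Rightarrow> (real \<Rightarrow> 'k) set" where
  "novikov_carrier K \<Gamma> =
     {a. (\<forall>g. a g \<in> carrier K) \<and> (\<forall>g. g \<notin> \<Gamma> \<longrightarrow> a g = \<zero>\<^bsub>K\<^esub>) \<and>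
         (\<forall>C. finite {g. g < C \<and> a g \<noteq> \<zero>\<^bsub>K\<^esub>})}"

definition novikov_field :: "('k, 'm) ring_scheme \<Rightarrow> real set \<Rightarrow> (real \<Rightarrow> 'k) ring" where
  "novikov_field K \<Gamma> =
     \<lparr>carrier = novikov_carrier K \<Gamma>,
      mult = (\<lambda>a b g. \<Oplus>\<^bsub>K\<^esub>h\<in>{h. a h \<noteq> \<zero>\<^bsub>K\<^esub> \<and> b (g - h) \<noteq> \<zero>\<^bsub>K\<^esub>}. a h \<otimes>\<^bsub>K\<^esub> b (g - h)),
      one = (\<lambda>g. if g = 0 then \<one>\<^bsub>K\<^esub> else \<zero>\<^bsub>K\<^esub>),
      zero = (\<lambda>g. \<zero>\<^bsub>K\<^esub>),
      add = (\<lambda>a b g. a g \<oplus>\<^bsub>K\<^esub> b g)\<rparr>"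

definition novikov_val :: "('k, 'm) ring_scheme \<Rightarrow> (real \<Rightarrow> 'k) \<Rightarrow> ereal" where
  "novikov_val K a =
     (if \<forall>g. a g = \<zero>\<^bsub>K\<^esub> then \<infinity> else ereal (LEAST g. a g \<noteq> \<zero>\<^bsub>K\<^esub>))"

text \<open>The vector spaces below require \<open>novikov_field K \<Gamma>\<close> to be a field, which it is.\<close>

context
  fixes K :: "('k, 'm) ring_scheme" (structure) and \<Gamma> :: "real set"
  assumes K: "field K" and \<Gamma>: "subgroup \<Gamma> real_add_group"
begin

interpretation field K by (rule K)

private abbreviation (input) \<Lambda> where "\<Lambda> \<equiv> novikov_field K \<Gamma>"

private lemma exponents: "0 \<in> \<Gamma>" "x \<in> \<Gamma> \<Longrightarrow> y \<in> \<Gamma> \<Longrightarrow> x + y \<in> \<Gamma>" "x \<in> \<Gamma> \<Longrightarrow> - x \<in> \<Gamma>"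
proof -
  have G: "group real_add_group"
  proof (rule groupI)
    fix x :: real assume "x \<in> carrier real_add_group"
    show "\<exists>y\<in>carrier real_add_group. y \<otimes>\<^bsub>real_add_group\<^esub> x = \<one>\<^bsub>real_add_group\<^esub>"
      by (rule bexI[of _ "- x"]) (simp_all add: real_add_group_def)
  qed (simp_all add: real_add_group_def)
  show "0 \<in> \<Gamma>" "x \<in> \<Gamma> \<Longrightarrow> y \<in> \<Gamma> \<Longrightarrow> x + y \<in> \<Gamma>"
    using subgroup.one_closed[OF \<Gamma>] subgroup.m_closed[OF \<Gamma>] by (auto simp: real_add_group_def)
  have "inv\<^bsub>real_add_group\<^esub> x = - x"
    by (rule group.inv_equality[OF G]) (auto simp: real_add_group_def)
  then show "x \<in> \<Gamma> \<Longrightarrow> - x \<in> \<Gamma>"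
    using subgroup.m_inv_closed[OF \<Gamma>, of x] by simp
qed

private lemma mult_def:
  "(a \<otimes>\<^bsub>\<Lambda>\<^esub> b) g = (\<Oplus>h\<in>{h. a h \<noteq> \<zero> \<and> b (g - h) \<noteq> \<zero>}. a h \<otimes> b (g - h))"
  by (simp add: novikov_field_def)

private lemma ops: "(a \<oplus>\<^bsub>\<Lambda>\<^esub> b) g = a g \<oplus> b g" "\<zero>\<^bsub>\<Lambda>\<^esub> g = \<zero>" "\<one>\<^bsub>\<Lambda>\<^esub> g = (if g = 0 then \<one> else \<zero>)"
  by (simp_all add: novikov_field_def)

private lemma car_iff: "a \<in> carrier \<Lambda> \<longleftrightarrow> (\<forall>g. a g \<in> carrier K) \<and> (\<forall>g. g \<notin> \<Gamma> \<longrightarrow> a g = \<zero>) \<and>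
         (\<forall>C. finite {g. g < C \<and> a g \<noteq> \<zero>})"
  by (simp add: novikov_field_def novikov_carrier_def)

private lemma carD: 
  assumes "a \<in> carrier \<Lambda>"
  shows "a g \<in> carrier K" "a g \<noteq> \<zero> \<Longrightarrow> g \<in> \<Gamma>" "finite {g. g < C \<and> a g \<noteq> \<zero>}"
  using assms by (auto simp: car_iff)

private lemma bounded:
  assumes "a \<in> carrier \<Lambda>"
  shows "\<exists>m. \<forall>g. a g \<noteq> \<zero> \<longrightarrow> m \<le> g"
proof (intro exI allI impI)
  fix g assume g: "a g \<noteq> \<zero>"
  let ?S = "insert 0 {g. g < 0 \<and> a g \<noteq> \<zero>}"
  have fin: "finite ?S" using carD(3)[OF assms] by simp
  show "Min ?S \<le> g"
  proof (cases "g < 0")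
    case True then show ?thesis using fin g by (intro Min_le) auto
  next
    case False
    have "Min ?S \<le> 0" using fin by (intro Min_le) auto
    then show ?thesis using False by linarith
  qed
qed

private lemma conv_finite:
  assumes a: "a \<in> carrier \<Lambda>" and b: "b \<in> carrier \<Lambda>"
  shows "finite {h. a h \<noteq> \<zero> \<and> b (g - h) \<noteq> \<zero>}"
proof -
  obtain m where m: "\<And>g. b g \<noteq> \<zero> \<Longrightarrow> m \<le> g" using bounded[OF b] by blast
  have "{h. a h \<noteq> \<zero> \<and> b (g - h) \<noteq> \<zero>} \<subseteq> {h. h < g - m + 1 \<and> a h \<noteq> \<zero>}"
    by (auto dest!: m)
  then show ?thesis using carD(3)[OF a] finite_subset by blast
qed

private lemma mult_superset:
  assumes a: "a \<in> carrier \<Lambda>" and b: "b \<in> carrier \<Lambda>" and F: "finite F"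
    "\<And>h. a h \<noteq> \<zero> \<Longrightarrow> b (g - h) \<noteq> \<zero> \<Longrightarrow> h \<in> F"
  shows "(a \<otimes>\<^bsub>\<Lambda>\<^esub> b) g = (\<Oplus>h\<in>F. a h \<otimes> b (g - h))"
  unfolding mult_def
proof (rule add.finprod_mono_neutral_cong_left)
  fix i assume "i \<in> F - {h. a h \<noteq> \<zero> \<and> b (g - h) \<noteq> \<zero>}"
  then have "a i = \<zero> \<or> b (g - i) = \<zero>" by auto
  then show "a i \<otimes> b (g - i) = \<zero>" using carD(1)[OF a] carD(1)[OF b] by auto
qed (use F carD(1)[OF a] carD(1)[OF b] in auto)

private lemma mult_nz:
  assumes a: "a \<in> carrier \<Lambda>" and b: "b \<in> carrier \<Lambda>" and nz: "(a \<otimes>\<^bsub>\<Lambda>\<^esub> b) g \<noteq> \<zero>"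
  obtains h where "a h \<noteq> \<zero>" "b (g - h) \<noteq> \<zero>"
proof -
  have "{h. a h \<noteq> \<zero> \<and> b (g - h) \<noteq> \<zero>} \<noteq> {}"
  proof
    assume "{h. a h \<noteq> \<zero> \<and> b (g - h) \<noteq> \<zero>} = {}"
    then have "(a \<otimes>\<^bsub>\<Lambda>\<^esub> b) g = \<zero>" unfolding mult_def by (simp only: finsum_empty)
    then show False using nz by simp
  qed
  then show ?thesis using that by blast
qed

private lemma mult_in: 
  assumes a: "a \<in> carrier \<Lambda>" and b: "b \<in> carrier \<Lambda>"
  shows "a \<otimes>\<^bsub>\<Lambda>\<^esub> b \<in> carrier \<Lambda>"
  unfolding car_iff
proof (intro conjI allI impI)
  fix g show "(a \<otimes>\<^bsub>\<Lambda>\<^esub> b) g \<in> carrier K"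
    unfolding mult_def using carD(1)[OF a] carD(1)[OF b] by (intro finsum_closed) auto
next
  fix g assume g: "g \<notin> \<Gamma>"
  show "(a \<otimes>\<^bsub>\<Lambda>\<^esub> b) g = \<zero>"
  proof (rule ccontr)
    assume "(a \<otimes>\<^bsub>\<Lambda>\<^esub> b) g \<noteq> \<zero>"
    then obtain h where "a h \<noteq> \<zero>" "b (g - h) \<noteq> \<zero>" by (rule mult_nz[OF a b])
    then have "h + (g - h) \<in> \<Gamma>" using carD(2)[OF a] carD(2)[OF b] exponents by blast
    then show False using g by simp
  qed
next
  fix C
  obtain ma where ma: "\<And>g. a g \<noteq> \<zero> \<Longrightarrow> ma \<le> g" using bounded[OF a] by blast
  obtain mb where mb: "\<And>g. b g \<noteq> \<zero> \<Longrightarrow> mb \<le> g" using bounded[OF b] by blast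
  let ?P = "{h. h < C - mb \<and> a h \<noteq> \<zero>} \<times> {h. h < C - ma \<and> b h \<noteq> \<zero>}"
  have "{g. g < C \<and> (a \<otimes>\<^bsub>\<Lambda>\<^esub> b) g \<noteq> \<zero>} \<subseteq> (\<lambda>(x, y). x + y) ` ?P"
  proof
    fix g assume "g \<in> {g. g < C \<and> (a \<otimes>\<^bsub>\<Lambda>\<^esub> b) g \<noteq> \<zero>}"
    then have g: "g < C" "(a \<otimes>\<^bsub>\<Lambda>\<^esub> b) g \<noteq> \<zero>" by auto
    from g(2) obtain h where h: "a h \<noteq> \<zero>" "b (g - h) \<noteq> \<zero>" by (rule mult_nz[OF a b])
    have "(h, g - h) \<in> ?P" using h g(1) ma[OF h(1)] mb[OF h(2)] by auto
    then show "g \<in> (\<lambda>(x, y). x + y) ` ?P" by (rule rev_image_eqI) simp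
  qed
  moreover have "finite ?P" using carD(3)[OF a] carD(3)[OF b] by blast
  ultimately show "finite {g. g < C \<and> (a \<otimes>\<^bsub>\<Lambda>\<^esub> b) g \<noteq> \<zero>}"
    by (meson finite_imageI finite_subset)
qed

private lemma mult_comm:
  assumes a: "a \<in> carrier \<Lambda>" and b: "b \<in> carrier \<Lambda>"
  shows "a \<otimes>\<^bsub>\<Lambda>\<^esub> b = b \<otimes>\<^bsub>\<Lambda>\<^esub> a"
proof
  fix g
  let ?S = "{h. a h \<noteq> \<zero> \<and> b (g - h) \<noteq> \<zero>}"
  have "{h. b h \<noteq> \<zero> \<and> a (g - h) \<noteq> \<zero>} = (\<lambda>h. g - h) ` ?S"
  proof (intro equalityI subsetI)
    fix h assume "h \<in> {h. b h \<noteq> \<zero> \<and> a (g - h) \<noteq> \<zero>}"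
    then show "h \<in> (\<lambda>h. g - h) ` ?S" by (intro image_eqI[of _ _ "g - h"]) simp_all
  qed auto
  then have "(b \<otimes>\<^bsub>\<Lambda>\<^esub> a) g = (\<Oplus>h\<in>(\<lambda>h. g - h) ` ?S. b h \<otimes> a (g - h))"
    unfolding mult_def by simp
  also have "\<dots> = (\<Oplus>h\<in>?S. b (g - h) \<otimes> a (g - (g - h)))"
    using carD(1)[OF a] carD(1)[OF b] by (intro finsum_reindex) (auto simp: inj_on_def)
  also have "\<dots> = (a \<otimes>\<^bsub>\<Lambda>\<^esub> b) g"
    unfolding mult_def using carD(1)[OF a] carD(1)[OF b] by (intro finsum_cong') (auto simp: m_comm)
  finally show "(a \<otimes>\<^bsub>\<Lambda>\<^esub> b) g = (b \<otimes>\<^bsub>\<Lambda>\<^esub> a) g" by simp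
qed

private lemma mult_superset':
  assumes a: "a \<in> carrier \<Lambda>" and b: "b \<in> carrier \<Lambda>" and F: "finite F"
    "\<And>h. b h \<noteq> \<zero> \<Longrightarrow> a (g - h) \<noteq> \<zero> \<Longrightarrow> h \<in> F"
  shows "(a \<otimes>\<^bsub>\<Lambda>\<^esub> b) g = (\<Oplus>h\<in>F. a (g - h) \<otimes> b h)"
proof -
  have "(b \<otimes>\<^bsub>\<Lambda>\<^esub> a) g = (\<Oplus>h\<in>F. b h \<otimes> a (g - h))"
    by (rule mult_superset[OF b a]) (use F in auto)
  also have "\<dots> = (\<Oplus>h\<in>F. a (g - h) \<otimes> b h)"
    using carD(1)[OF a] carD(1)[OF b] by (intro finsum_cong') (auto simp: m_comm)
  finally show ?thesis by (simp add: mult_comm[OF a b])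
qed

private lemma mult_assoc:
  assumes a: "a \<in> carrier \<Lambda>" and b: "b \<in> carrier \<Lambda>" and c: "c \<in> carrier \<Lambda>"
  shows "(a \<otimes>\<^bsub>\<Lambda>\<^esub> b) \<otimes>\<^bsub>\<Lambda>\<^esub> c = a \<otimes>\<^bsub>\<Lambda>\<^esub> (b \<otimes>\<^bsub>\<Lambda>\<^esub> c)"
proof
  fix g
  obtain ma where ma: "\<And>g. a g \<noteq> \<zero> \<Longrightarrow> ma \<le> g" using bounded[OF a] by blast
  obtain mb where mb: "\<And>g. b g \<noteq> \<zero> \<Longrightarrow> mb \<le> g" using bounded[OF b] by blast
  obtain mc where mc: "\<And>g. c g \<noteq> \<zero> \<Longrightarrow> mc \<le> g" using bounded[OF c] by blast
  have mab: "ma + mb \<le> g" if "(a \<otimes>\<^bsub>\<Lambda>\<^esub> b) g \<noteq> \<zero>" for g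
    using that by (rule mult_nz[OF a b]) (drule ma, drule mb, simp)
  have mbc: "mb + mc \<le> g" if "(b \<otimes>\<^bsub>\<Lambda>\<^esub> c) g \<noteq> \<zero>" for g
    using that by (rule mult_nz[OF b c]) (drule mb, drule mc, simp)
  define A where "A = {h. h < g - mb - mc + 1 \<and> a h \<noteq> \<zero>}"
  define C where "C = {h. h < g - ma - mb + 1 \<and> c h \<noteq> \<zero>}"
  have fin: "finite A" "finite C" unfolding A_def C_def using carD(3)[OF a] carD(3)[OF c] by auto
  note car = carD(1)[OF a] carD(1)[OF b] carD(1)[OF c]
  have ab: "(a \<otimes>\<^bsub>\<Lambda>\<^esub> b) (g - z) = (\<Oplus>x\<in>A. a x \<otimes> b (g - z - x))" if "z \<in> C" for z
    using that by (intro mult_superset[OF a b fin(1)]) (auto simp: A_def C_def dest!: mb mc)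
  have bc: "(b \<otimes>\<^bsub>\<Lambda>\<^esub> c) (g - x) = (\<Oplus>z\<in>C. b (g - x - z) \<otimes> c z)" if "x \<in> A" for x
    using that by (intro mult_superset'[OF b c fin(2)]) (auto simp: A_def C_def dest!: ma mb)
  have "((a \<otimes>\<^bsub>\<Lambda>\<^esub> b) \<otimes>\<^bsub>\<Lambda>\<^esub> c) g = (\<Oplus>z\<in>C. (a \<otimes>\<^bsub>\<Lambda>\<^esub> b) (g - z) \<otimes> c z)"
    by (rule mult_superset'[OF mult_in[OF a b] c fin(2)]) (auto simp: C_def dest!: mab)
  also have "\<dots> = (\<Oplus>z\<in>C. \<Oplus>x\<in>A. a x \<otimes> b (g - z - x) \<otimes> c z)"
    using car by (intro finsum_cong') (auto simp: ab finsum_ldistr[OF fin(1)] intro!: finsum_closed)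
  also have "\<dots> = (\<Oplus>x\<in>A. \<Oplus>z\<in>C. a x \<otimes> b (g - z - x) \<otimes> c z)"
    using car by (intro finsum_finsum_swap fin) auto
  also have "\<dots> = (\<Oplus>x\<in>A. a x \<otimes> (b \<otimes>\<^bsub>\<Lambda>\<^esub> c) (g - x))"
    using car
    by (intro finsum_cong') (auto simp: bc finsum_rdistr[OF fin(2)] m_assoc algebra_simps
      intro!: finsum_closed finsum_cong')
  also have "\<dots> = (a \<otimes>\<^bsub>\<Lambda>\<^esub> (b \<otimes>\<^bsub>\<Lambda>\<^esub> c)) g"
    by (rule mult_superset[OF a mult_in[OF b c] fin(1), symmetric]) (auto simp: A_def dest!: mbc)
  finally show "((a \<otimes>\<^bsub>\<Lambda>\<^esub> b) \<otimes>\<^bsub>\<Lambda>\<^esub> c) g = (a \<otimes>\<^bsub>\<Lambda>\<^esub> (b \<otimes>\<^bsub>\<Lambda>\<^esub> c)) g" .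
qed

private lemma add_in:
  assumes a: "a \<in> carrier \<Lambda>" and b: "b \<in> carrier \<Lambda>"
  shows "a \<oplus>\<^bsub>\<Lambda>\<^esub> b \<in> carrier \<Lambda>"
  unfolding car_iff ops
proof (intro conjI allI impI)
  fix C
  have "{g. g < C \<and> a g \<oplus> b g \<noteq> \<zero>} \<subseteq> {g. g < C \<and> a g \<noteq> \<zero>} \<union> {g. g < C \<and> b g \<noteq> \<zero>}"
    by auto
  then show "finite {g. g < C \<and> a g \<oplus> b g \<noteq> \<zero>}"
    using carD(3)[OF a] carD(3)[OF b] by (meson finite_Un finite_subset)
qed (use a b in \<open>auto simp: car_iff\<close>)

private lemma neg_in:
  assumes a: "a \<in> carrier \<Lambda>"
  shows "(\<lambda>g. \<ominus> a g) \<in> carrier \<Lambda>"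
proof -
  have "\<ominus> a g = \<zero> \<longleftrightarrow> a g = \<zero>" for g
    using carD(1)[OF a, of g] by (metis minus_minus minus_zero)
  then show ?thesis using a by (auto simp: car_iff)
qed

private lemma mono_in:
  assumes "h \<in> \<Gamma>" "x \<in> carrier K"
  shows "(\<lambda>g. if g = h then x else \<zero>) \<in> carrier \<Lambda>"
proof -
  have "finite {g. g < C \<and> (if g = h then x else \<zero>) \<noteq> \<zero>}" for C
    by (rule finite_subset[of _ "{h}"]) auto
  then show ?thesis using assms by (auto simp: car_iff)
qed

private lemma mono_mult:
  assumes h: "h \<in> \<Gamma>" and x: "x \<in> carrier K" and a: "a \<in> carrier \<Lambda>"
  shows "((\<lambda>g. if g = h then x else \<zero>) \<otimes>\<^bsub>\<Lambda>\<^esub> a) g = x \<otimes> a (g - h)"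
proof -
  have "((\<lambda>g. if g = h then x else \<zero>) \<otimes>\<^bsub>\<Lambda>\<^esub> a) g =
    (\<Oplus>i\<in>{h}. (if i = h then x else \<zero>) \<otimes> a (g - i))"
    by (rule mult_superset[OF mono_in[OF h x] a]) (simp_all split: if_splits)
  also have "\<dots> = x \<otimes> a (g - h)" using x carD(1)[OF a] by simp
  finally show ?thesis .
qed

private lemma one_eq: "\<one>\<^bsub>\<Lambda>\<^esub> = (\<lambda>g. if g = 0 then \<one> else \<zero>)"
  by (simp add: novikov_field_def)

private lemma novikov_cring: "cring \<Lambda>"
proof (rule cringI)
  show "abelian_group \<Lambda>"
  proof (rule abelian_groupI)
    show "\<zero>\<^bsub>\<Lambda>\<^esub> \<in> carrier \<Lambda>" by (simp add: car_iff ops)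
    fix x assume x: "x \<in> carrier \<Lambda>"
    show "\<exists>y\<in>carrier \<Lambda>. y \<oplus>\<^bsub>\<Lambda>\<^esub> x = \<zero>\<^bsub>\<Lambda>\<^esub>"
      using carD(1)[OF x] by (intro bexI[OF _ neg_in[OF x]] ext) (simp add: ops l_neg)
  next
    fix x y assume "x \<in> carrier \<Lambda>" "y \<in> carrier \<Lambda>"
    then show "x \<oplus>\<^bsub>\<Lambda>\<^esub> y \<in> carrier \<Lambda>" by (rule add_in)
  next
    fix x y assume x: "x \<in> carrier \<Lambda>" and y: "y \<in> carrier \<Lambda>"
    show "x \<oplus>\<^bsub>\<Lambda>\<^esub> y = y \<oplus>\<^bsub>\<Lambda>\<^esub> x"
      by (rule ext) (simp only: ops a_comm[OF carD(1)[OF x] carD(1)[OF y]])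
  next
    fix x y z assume x: "x \<in> carrier \<Lambda>" and y: "y \<in> carrier \<Lambda>" and z: "z \<in> carrier \<Lambda>"
    show "x \<oplus>\<^bsub>\<Lambda>\<^esub> y \<oplus>\<^bsub>\<Lambda>\<^esub> z = x \<oplus>\<^bsub>\<Lambda>\<^esub> (y \<oplus>\<^bsub>\<Lambda>\<^esub> z)"
      by (rule ext) (simp only: ops a_assoc[OF carD(1)[OF x] carD(1)[OF y] carD(1)[OF z]])
  next
    fix x assume x: "x \<in> carrier \<Lambda>"
    show "\<zero>\<^bsub>\<Lambda>\<^esub> \<oplus>\<^bsub>\<Lambda>\<^esub> x = x"
      by (rule ext) (simp only: ops l_zero[OF carD(1)[OF x]])
  qed
  show "comm_monoid \<Lambda>"
  proof (rule comm_monoidI)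
    show "\<one>\<^bsub>\<Lambda>\<^esub> \<in> carrier \<Lambda>" unfolding one_eq by (intro mono_in exponents) simp
    fix x assume x: "x \<in> carrier \<Lambda>"
    show "\<one>\<^bsub>\<Lambda>\<^esub> \<otimes>\<^bsub>\<Lambda>\<^esub> x = x"
      unfolding one_eq using mono_mult[OF exponents(1) one_closed x] carD(1)[OF x] by (intro ext) simp
  qed (fact mult_in mult_assoc mult_comm)+
  fix a b c assume a: "a \<in> carrier \<Lambda>" and b: "b \<in> carrier \<Lambda>" and c: "c \<in> carrier \<Lambda>"
  show "(a \<oplus>\<^bsub>\<Lambda>\<^esub> b) \<otimes>\<^bsub>\<Lambda>\<^esub> c = a \<otimes>\<^bsub>\<Lambda>\<^esub> c \<oplus>\<^bsub>\<Lambda>\<^esub> b \<otimes>\<^bsub>\<Lambda>\<^esub> c"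
  proof
    fix g
    define F where "F = {h. a h \<noteq> \<zero> \<and> c (g - h) \<noteq> \<zero>} \<union> {h. b h \<noteq> \<zero> \<and> c (g - h) \<noteq> \<zero>}"
    have F: "finite F" unfolding F_def using conv_finite[OF a c] conv_finite[OF b c] by blast
    note car = carD(1)[OF a] carD(1)[OF b] carD(1)[OF c]
    have "((a \<oplus>\<^bsub>\<Lambda>\<^esub> b) \<otimes>\<^bsub>\<Lambda>\<^esub> c) g = (\<Oplus>h\<in>F. (a h \<oplus> b h) \<otimes> c (g - h))"
      unfolding ops(1)[symmetric]
    proof (rule mult_superset[OF add_in[OF a b] c F])
      fix h assume h: "(a \<oplus>\<^bsub>\<Lambda>\<^esub> b) h \<noteq> \<zero>" "c (g - h) \<noteq> \<zero>"
      have "a h \<noteq> \<zero> \<or> b h \<noteq> \<zero>" using h(1) by (auto simp: ops)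
      then show "h \<in> F" using h(2) by (auto simp: F_def)
    qed
    also have "\<dots> = (\<Oplus>h\<in>F. a h \<otimes> c (g - h) \<oplus> b h \<otimes> c (g - h))"
      using car by (intro finsum_cong') (auto simp: l_distr)
    also have "\<dots> = (\<Oplus>h\<in>F. a h \<otimes> c (g - h)) \<oplus> (\<Oplus>h\<in>F. b h \<otimes> c (g - h))"
      using car by (intro finsum_addf) auto
    also have "\<dots> = (a \<otimes>\<^bsub>\<Lambda>\<^esub> c) g \<oplus> (b \<otimes>\<^bsub>\<Lambda>\<^esub> c) g"
      using mult_superset[OF a c F, of g] mult_superset[OF b c F, of g] by (simp add: F_def)
    finally show "((a \<oplus>\<^bsub>\<Lambda>\<^esub> b) \<otimes>\<^bsub>\<Lambda>\<^esub> c) g = (a \<otimes>\<^bsub>\<Lambda>\<^esub> c \<oplus>\<^bsub>\<Lambda>\<^esub> b \<otimes>\<^bsub>\<Lambda>\<^esub> c) g" by (simp add: ops)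
  qed
qed

text \<open>The geometric series: its partial sums \<open>S n\<close> stabilise below every bound.\<close>

private lemma geometric:
  assumes u: "u \<in> carrier \<Lambda>" and \<delta>: "0 < \<delta>" "\<And>g. u g \<noteq> \<zero> \<Longrightarrow> \<delta> \<le> g"
  shows "\<exists>b\<in>carrier \<Lambda>. b = \<one>\<^bsub>\<Lambda>\<^esub> \<oplus>\<^bsub>\<Lambda>\<^esub> u \<otimes>\<^bsub>\<Lambda>\<^esub> b"
proof -
  have one_in: "\<one>\<^bsub>\<Lambda>\<^esub> \<in> carrier \<Lambda>" unfolding one_eq by (intro mono_in exponents) simp
  have cong: "(u \<otimes>\<^bsub>\<Lambda>\<^esub> s) g = (u \<otimes>\<^bsub>\<Lambda>\<^esub> t) g" if "\<And>h. \<delta> \<le> h \<Longrightarrow> s (g - h) = t (g - h)" 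
    and "s \<in> carrier \<Lambda>" "t \<in> carrier \<Lambda>" for s t g
  proof -
    have eq: "s (g - h) = t (g - h)" if "u h \<noteq> \<zero>" for h
      using that by (intro \<open>\<And>h. \<delta> \<le> h \<Longrightarrow> s (g - h) = t (g - h)\<close> \<delta>(2))
    then have "{h. u h \<noteq> \<zero> \<and> s (g - h) \<noteq> \<zero>} = {h. u h \<noteq> \<zero> \<and> t (g - h) \<noteq> \<zero>}"
      using eq by (intro Collect_cong) auto
    then show ?thesis unfolding mult_def
      using eq carD(1)[OF u] carD(1)[OF that(3)] by (intro finsum_cong') simp_all
  qed
  define S where "S n = ((\<lambda>s. \<one>\<^bsub>\<Lambda>\<^esub> \<oplus>\<^bsub>\<Lambda>\<^esub> u \<otimes>\<^bsub>\<Lambda>\<^esub> s) ^^ n) \<one>\<^bsub>\<Lambda>\<^esub>" for n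
  have S_Suc: "S (Suc n) = \<one>\<^bsub>\<Lambda>\<^esub> \<oplus>\<^bsub>\<Lambda>\<^esub> u \<otimes>\<^bsub>\<Lambda>\<^esub> S n" for n by (simp add: S_def)
  have S_in: "S n \<in> carrier \<Lambda>" for n
  proof (induction n)
    case 0 show ?case using one_in by (simp add: S_def)
  next
    case (Suc n) then show ?case unfolding S_Suc by (intro add_in mult_in one_in u)
  qed
  have step: "g < real (Suc n) * \<delta> \<Longrightarrow> S (Suc n) g = S n g" for n g
  proof (induction n arbitrary: g)
    case 0
    have "(u \<otimes>\<^bsub>\<Lambda>\<^esub> \<one>\<^bsub>\<Lambda>\<^esub>) g = \<zero>" 
    proof -
      have "u g = \<zero>" using 0 \<delta>(2)[of g] by fastforce
      then show ?thesis unfolding mult_comm[OF u one_in]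
        using mono_mult[OF exponents(1) one_closed u, of g] by (simp add: one_eq)
    qed
    then have "S (Suc 0) g = \<one>\<^bsub>\<Lambda>\<^esub> g"
      unfolding S_Suc by (simp add: S_def ops)
    then show ?case by (simp add: S_def)
  next
    case (Suc n)
    have "(u \<otimes>\<^bsub>\<Lambda>\<^esub> S (Suc n)) g = (u \<otimes>\<^bsub>\<Lambda>\<^esub> S n) g"
      using Suc.prems by (intro cong S_in Suc.IH) (auto simp: algebra_simps)
    then show ?case unfolding S_Suc[of "Suc n"] by (simp add: ops S_Suc[of n])
  qed
  have stable: "S m g = S n g" if "n \<le> m" "g < real (Suc n) * \<delta>" for m n g
    using that(1)
  proof (induction m rule: dec_induct)
    case (step m)
    have "real (Suc n) * \<delta> \<le> real (Suc m) * \<delta>" using step(1) \<delta>(1) by (intro mult_right_mono) auto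
    then show ?case using step \<open>\<And>n g. g < real (Suc n) * \<delta> \<Longrightarrow> S (Suc n) g = S n g\<close>[of g m] that(2)
      by simp
  qed simp
  have large: "\<exists>n. g < real (Suc n) * \<delta>" for g
  proof -
    obtain n :: nat where n: "g < real n * \<delta>" using reals_Archimedean3[OF \<delta>(1)] by blast
    have "real n * \<delta> \<le> real (Suc n) * \<delta>" using \<delta>(1) by (intro mult_right_mono) simp_all
    then show ?thesis using n by (intro exI[of _ n]) linarith
  qed
  define b where "b g = S (LEAST n. g < real (Suc n) * \<delta>) g" for g
  have b_eq: "b g = S n g" if "g < real (Suc n) * \<delta>" for g n
    unfolding b_def
    by (rule stable[symmetric]) (use that in \<open>auto intro: Least_le LeastI\<close>)
  have b: "b \<in> carrier \<Lambda>"
    unfolding car_iff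
  proof (intro conjI allI impI)
    fix C
    obtain n where n: "C < real (Suc n) * \<delta>" using large by blast
    have "{g. g < C \<and> b g \<noteq> \<zero>} = {g. g < C \<and> S n g \<noteq> \<zero>}"
      using b_eq[of _ n] n by auto
    then show "finite {g. g < C \<and> b g \<noteq> \<zero>}" using carD(3)[OF S_in] by simp
  qed (use carD[OF S_in] in \<open>auto simp: b_def\<close>)
  have "b = \<one>\<^bsub>\<Lambda>\<^esub> \<oplus>\<^bsub>\<Lambda>\<^esub> u \<otimes>\<^bsub>\<Lambda>\<^esub> b"
  proof
    fix g
    obtain n where n: "g < real (Suc n) * \<delta>" using large by blast
    have "(u \<otimes>\<^bsub>\<Lambda>\<^esub> b) g = (u \<otimes>\<^bsub>\<Lambda>\<^esub> S n) g"
      using n \<delta>(1) by (intro cong b S_in b_eq) auto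
    moreover have "b g = S (Suc n) g" 
    proof (rule b_eq)
      show "g < real (Suc (Suc n)) * \<delta>" using n \<delta>(1) by (simp add: algebra_simps)
    qed
    ultimately show "b g = (\<one>\<^bsub>\<Lambda>\<^esub> \<oplus>\<^bsub>\<Lambda>\<^esub> u \<otimes>\<^bsub>\<Lambda>\<^esub> b) g" by (simp add: S_Suc ops)
  qed
  then show ?thesis using b by blast
qed

lemma field_novikov_field: "field (novikov_field K \<Gamma>)"
proof -
  interpret L: cring \<Lambda> by (rule novikov_cring)
  show ?thesis
  proof (rule L.cring_fieldI2)
    show "\<zero>\<^bsub>\<Lambda>\<^esub> \<noteq> \<one>\<^bsub>\<Lambda>\<^esub>"
    proof
      assume "\<zero>\<^bsub>\<Lambda>\<^esub> = \<one>\<^bsub>\<Lambda>\<^esub>"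
      from fun_cong[OF this, of 0] show False by (simp add: ops)
    qed
    fix a assume a: "a \<in> carrier \<Lambda>" and "a \<noteq> \<zero>\<^bsub>\<Lambda>\<^esub>"
    then obtain g0 where g0: "a g0 \<noteq> \<zero>" by (auto simp: fun_eq_iff ops)
    let ?A = "{g. g < g0 + 1 \<and> a g \<noteq> \<zero>}"
    have A: "finite ?A" "?A \<noteq> {}" using carD(3)[OF a] g0 by (auto intro!: exI[of _ g0])
    define m where "m = Min ?A"
    have am: "a m \<noteq> \<zero>" using Min_in[OF A] by (auto simp: m_def)
    have m_le: "m \<le> g" if "a g \<noteq> \<zero>" for g
    proof (cases "g < g0 + 1")
      case True then show ?thesis unfolding m_def using that A by (intro Min_le) auto
    next
      case False
      have "m \<le> g0" unfolding m_def using g0 A by (intro Min_le) auto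
      then show ?thesis using False by linarith
    qed
    have inv: "inv (a m) \<in> carrier K" "inv (a m) \<otimes> a m = \<one>"
      using am carD(1)[OF a, of m] field_Units by (auto intro: Units_l_inv)
    define s where "s = (\<lambda>g. if g = - m then inv (a m) else \<zero>)"
    have mG: "- m \<in> \<Gamma>" using carD(2)[OF a am] exponents by blast
    have s: "s \<in> carrier \<Lambda>" unfolding s_def by (rule mono_in[OF mG inv(1)])
    have sa: "(s \<otimes>\<^bsub>\<Lambda>\<^esub> a) g = inv (a m) \<otimes> a (g + m)" for g
      unfolding s_def using mono_mult[OF mG inv(1) a, of g] by simp
    define u where "u = \<one>\<^bsub>\<Lambda>\<^esub> \<ominus>\<^bsub>\<Lambda>\<^esub> s \<otimes>\<^bsub>\<Lambda>\<^esub> a"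
    have u: "u \<in> carrier \<Lambda>" unfolding u_def using s a by simp
    have one_eq: "\<one>\<^bsub>\<Lambda>\<^esub> = u \<oplus>\<^bsub>\<Lambda>\<^esub> s \<otimes>\<^bsub>\<Lambda>\<^esub> a"
      unfolding u_def using s a by (simp add: a_minus_def L.a_assoc L.l_neg)
    have u_pos: "0 < g" if "u g \<noteq> \<zero>" for g
    proof (rule ccontr)
      assume "\<not> 0 < g"
      have *: "\<one>\<^bsub>\<Lambda>\<^esub> g = u g \<oplus> inv (a m) \<otimes> a (g + m)"
        using fun_cong[OF one_eq, of g] by (simp add: ops sa)
      have ug: "u g \<in> carrier K" using carD(1)[OF u] .
      show False
      proof (cases "g = 0")
        case True
        then have "\<one> = u g \<oplus> \<one>" using * inv(2) by (simp add: ops)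
        then show False using that ug by (metis add.r_cancel_one' one_closed)
      next
        case False
        then have "a (g + m) = \<zero>" using m_le[of "g + m"] \<open>\<not> 0 < g\<close> by fastforce
        then show False using * that ug inv(1) False by (simp add: ops)
      qed
    qed
    let ?U = "insert 1 {g. g < 1 \<and> u g \<noteq> \<zero>}"
    have U: "finite ?U" using carD(3)[OF u] by simp
    have \<delta>: "0 < Min ?U" using U u_pos by (subst Min_gr_iff) auto
    have \<delta>': "Min ?U \<le> g" if "u g \<noteq> \<zero>" for g
    proof (cases "g < 1")
      case True then show ?thesis using that U by (intro Min_le) auto
    next
      case False
      have "Min ?U \<le> 1" using U by (intro Min_le) auto
      then show ?thesis using False by linarith
    qed
    obtain b where b: "b \<in> carrier \<Lambda>" "b = \<one>\<^bsub>\<Lambda>\<^esub> \<oplus>\<^bsub>\<Lambda>\<^esub> u \<otimes>\<^bsub>\<Lambda>\<^esub> b"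
      using geometric[OF u \<delta> \<delta>'] by blast
    let ?p = "a \<otimes>\<^bsub>\<Lambda>\<^esub> (s \<otimes>\<^bsub>\<Lambda>\<^esub> b)"
    have "b = (u \<oplus>\<^bsub>\<Lambda>\<^esub> s \<otimes>\<^bsub>\<Lambda>\<^esub> a) \<otimes>\<^bsub>\<Lambda>\<^esub> b" using one_eq[symmetric] b(1) by simp
    also have "\<dots> = u \<otimes>\<^bsub>\<Lambda>\<^esub> b \<oplus>\<^bsub>\<Lambda>\<^esub> (s \<otimes>\<^bsub>\<Lambda>\<^esub> a) \<otimes>\<^bsub>\<Lambda>\<^esub> b"
      using u s a b(1) by (simp add: L.l_distr)
    also have "\<dots> = ?p \<oplus>\<^bsub>\<Lambda>\<^esub> u \<otimes>\<^bsub>\<Lambda>\<^esub> b"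
      using u s a b(1) by (simp add: L.m_ac L.a_ac)
    finally have "?p \<oplus>\<^bsub>\<Lambda>\<^esub> u \<otimes>\<^bsub>\<Lambda>\<^esub> b = \<one>\<^bsub>\<Lambda>\<^esub> \<oplus>\<^bsub>\<Lambda>\<^esub> u \<otimes>\<^bsub>\<Lambda>\<^esub> b" using b(2) by simp
    then have "?p = \<one>\<^bsub>\<Lambda>\<^esub>" using u s a b(1) by (simp add: L.add.right_cancel)
    then show "\<exists>b\<in>carrier \<Lambda>. a \<otimes>\<^bsub>\<Lambda>\<^esub> b = \<one>\<^bsub>\<Lambda>\<^esub>" using s b(1) by (intro bexI[of _ "s \<otimes>\<^bsub>\<Lambda>\<^esub> b"]) auto
  qed
qed

end

section \<open>Orthogonalizable spaces\<close>

text \<open>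
  The codomain \<open>\<real> \<union> {-\<infinity>}\<close> of the filtration \<open>l\<close> is rendered by extended reals different
  from \<open>\<infinity>\<close>, so none of the differences below is of the form \<open>\<infinity> - \<infinity>\<close>.
\<close>

locale nonarch_normed_space =
  fixes K :: "('k, 'm) ring_scheme" and \<Gamma> :: "real set"
    and V :: "(real \<Rightarrow> 'k, 'v, 'n) module_scheme" and l :: "'v \<Rightarrow> ereal"
  assumes vectorspace: "vectorspace (novikov_field K \<Gamma>) V"
    and not_PInf: "x \<in> carrier V \<Longrightarrow> l x \<noteq> \<infinity>"
    and eq_MInf_iff: "x \<in> carrier V \<Longrightarrow> l x = -\<infinity> \<longleftrightarrow> x = \<zero>\<^bsub>V\<^esub>"
    and smult: "c \<in> carrier (novikov_field K \<Gamma>) \<Longrightarrow> x \<in> carrier V \<Longrightarrow>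
                  l (c \<odot>\<^bsub>V\<^esub> x) = l x - novikov_val K c"
    and ultrametric: "x \<in> carrier V \<Longrightarrow> y \<in> carrier V \<Longrightarrow>
                  l (x \<oplus>\<^bsub>V\<^esub> y) \<le> max (l x) (l y)"

text \<open>Maxima over finite index sets are written as suprema in \<open>ereal\<close>; the empty maximum
  is therefore \<open>-\<infinity>\<close>.\<close>

definition orthogonal_family ::
  "('k, 'm) ring_scheme \<Rightarrow> real set \<Rightarrow> (real \<Rightarrow> 'k, 'v, 'n) module_scheme \<Rightarrow> ('v \<Rightarrow> ereal)
    \<Rightarrow> 'v list \<Rightarrow> bool" where
  "orthogonal_family K \<Gamma> V l ws \<longleftrightarrow> set ws \<subseteq> carrier V \<and>
     (\<forall>c. (\<forall>i<length ws. c i \<in> carrier (novikov_field K \<Gamma>)) \<longrightarrow>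
        l (\<Oplus>\<^bsub>V\<^esub>i\<in>{..<length ws}. c i \<odot>\<^bsub>V\<^esub> ws ! i) =
          (SUP i\<in>{..<length ws}. l (c i \<odot>\<^bsub>V\<^esub> ws ! i)))"

definition ordered_basis ::
  "('a, 'm) ring_scheme \<Rightarrow> ('a, 'v, 'n) module_scheme \<Rightarrow> 'v list \<Rightarrow> bool" where
  "ordered_basis F V ws \<longleftrightarrow> distinct ws \<and> vectorspace.basis F V (set ws)"

definition orthogonal_basis ::
  "('k, 'm) ring_scheme \<Rightarrow> real set \<Rightarrow> (real \<Rightarrow> 'k, 'v, 'n) module_scheme \<Rightarrow> ('v \<Rightarrow> ereal)
    \<Rightarrow> 'v list \<Rightarrow> bool" where
  "orthogonal_basis K \<Gamma> V l ws \<longleftrightarrow>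
     ordered_basis (novikov_field K \<Gamma>) V ws \<and> orthogonal_family K \<Gamma> V l ws"

definition orthogonalizable ::
  "('k, 'm) ring_scheme \<Rightarrow> real set \<Rightarrow> (real \<Rightarrow> 'k, 'v, 'n) module_scheme \<Rightarrow> ('v \<Rightarrow> ereal)
    \<Rightarrow> bool" where
  "orthogonalizable K \<Gamma> V l \<longleftrightarrow>
     nonarch_normed_space K \<Gamma> V l \<and> vectorspace.fin_dim (novikov_field K \<Gamma>) V \<and>
     (\<exists>ws. orthogonal_basis K \<Gamma> V l ws)"

section \<open>Singular value decompositions\<close>

text \<open>A subspace with carrier \<open>W\<close> of \<open>V\<close> is the record \<open>V\<lparr>carrier := W\<rparr>\<close>, as in the
  vector space library.\<close>

definition image_space ::
  "('a, 'v, 'n) module_scheme \<Rightarrow> ('a, 'w, 'p) module_scheme \<Rightarrow> ('v \<Rightarrow> 'w)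
    \<Rightarrow> ('a, 'w, 'p) module_scheme" where
  "image_space V W A = W\<lparr>carrier := mod_hom.im V A\<rparr>"

definition kernel_space ::
  "('a, 'v, 'n) module_scheme \<Rightarrow> ('a, 'w, 'p) module_scheme \<Rightarrow> ('v \<Rightarrow> 'w)
    \<Rightarrow> ('a, 'v, 'n) module_scheme" where
  "kernel_space V W A = V\<lparr>carrier := mod_hom.ker V W A\<rparr>"

definition map_rank ::
  "('a, 'm) ring_scheme \<Rightarrow> ('a, 'v, 'n) module_scheme \<Rightarrow> ('a, 'w, 'p) module_scheme
    \<Rightarrow> ('v \<Rightarrow> 'w) \<Rightarrow> nat" where
  "map_rank F V W A = vectorspace.dim F (image_space V W A)"

definition singular_value_decomposition ::
  "('k, 'm) ring_scheme \<Rightarrow> real set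
    \<Rightarrow> (real \<Rightarrow> 'k, 'v, 'n) module_scheme \<Rightarrow> ('v \<Rightarrow> ereal)
    \<Rightarrow> (real \<Rightarrow> 'k, 'w, 'p) module_scheme \<Rightarrow> ('w \<Rightarrow> ereal)
    \<Rightarrow> ('v \<Rightarrow> 'w) \<Rightarrow> 'v list \<Rightarrow> 'w list \<Rightarrow> bool" where
  "singular_value_decomposition K \<Gamma> V lV W lW A ys xs \<longleftrightarrow>
     (let r = map_rank (novikov_field K \<Gamma>) V W A in
        orthogonal_basis K \<Gamma> V lV ys \<and>
        orthogonal_basis K \<Gamma> W lW xs \<and>
        orthogonal_basis K \<Gamma> (kernel_space V W A) lV (drop r ys) \<and>
        orthogonal_basis K \<Gamma> (image_space V W A) lW (take r xs) \<and>
        (\<forall>i<r. A (ys ! i) = xs ! i) \<and>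
        (\<forall>i j. i \<le> j \<and> j < r \<longrightarrow> lV (ys ! j) - lW (xs ! j) \<le> lV (ys ! i) - lW (xs ! i)))"

section \<open>Floer-type complexes\<close>

text \<open>
  The graded pieces are separate modules \<open>C k\<close>, with differentials \<open>d k : C k \<rightarrow> C (k - 1)\<close>
  and filtrations \<open>l k\<close> indexed by the degree: their carriers share one type and need not be
  disjoint.
\<close>

locale floer_type_complex =
  fixes K :: "('k, 'm) ring_scheme" and \<Gamma> :: "real set"
    and C :: "int \<Rightarrow> (real \<Rightarrow> 'k, 'c, 'n) module_scheme"
    and d :: "int \<Rightarrow> 'c \<Rightarrow> 'c" and l :: "int \<Rightarrow> 'c \<Rightarrow> ereal"
  assumes orthogonalizable: "orthogonalizable K \<Gamma> (C k) (l k)"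
    and differential: "d k \<in> LinearCombinations.module_hom (novikov_field K \<Gamma>) (C k) (C (k - 1))"
    and differential_square: "x \<in> carrier (C k) \<Longrightarrow> d (k - 1) (d k x) = \<zero>\<^bsub>C (k - 1 - 1)\<^esub>"
    and filtration: "x \<in> carrier (C k) \<Longrightarrow> l (k - 1) (d k x) \<le> l k x"

definition cycle_space ::
  "(int \<Rightarrow> ('a, 'c, 'n) module_scheme) \<Rightarrow> (int \<Rightarrow> 'c \<Rightarrow> 'c) \<Rightarrow> int
    \<Rightarrow> ('a, 'c, 'n) module_scheme" where
  "cycle_space C d k = kernel_space (C k) (C (k - 1)) (d k)"

definition boundaries ::
  "(int \<Rightarrow> ('a, 'c, 'n) module_scheme) \<Rightarrow> (int \<Rightarrow> 'c \<Rightarrow> 'c) \<Rightarrow> int \<Rightarrow> 'c set" where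
  "boundaries C d k = mod_hom.im (C (k + 1)) (d (k + 1))"

text \<open>
  The scalar \<open>a\<close> maps the coset \<open>N + x\<close> to \<open>N + a x\<close>; all cosets in the union below agree.
  The ring multiplication and unit of a module record are irrelevant.
\<close>

definition quotient_module ::
  "('a, 'c, 'n) module_scheme \<Rightarrow> 'c set \<Rightarrow> ('a, 'c set) module" where
  "quotient_module M N =
     \<lparr>carrier = a_rcosets\<^bsub>M\<^esub> N, mult = undefined, one = undefined,
      zero = N, add = set_add M,
      smult = (\<lambda>a X. \<Union>x\<in>X. N +>\<^bsub>M\<^esub> (a \<odot>\<^bsub>M\<^esub> x))\<rparr>"

definition homology ::
  "(int \<Rightarrow> ('a, 'c, 'n) module_scheme) \<Rightarrow> (int \<Rightarrow> 'c \<Rightarrow> 'c) \<Rightarrow> int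
    \<Rightarrow> ('a, 'c set) module" where
  "homology C d k = quotient_module (cycle_space C d k) (boundaries C d k)"

definition spectral_invariant ::
  "(int \<Rightarrow> ('a, 'c, 'n) module_scheme) \<Rightarrow> (int \<Rightarrow> 'c \<Rightarrow> 'c) \<Rightarrow> (int \<Rightarrow> 'c \<Rightarrow> ereal)
    \<Rightarrow> int \<Rightarrow> 'c set \<Rightarrow> ereal" where
  "spectral_invariant C d l k \<alpha> =
     Inf {l k c | c. c \<in> carrier (C k) \<and> d k c = \<zero>\<^bsub>C (k - 1)\<^esub> \<and>
                     boundaries C d k +>\<^bsub>cycle_space C d k\<^esub> c = \<alpha>}"

section \<open>Concise barcodes\<close>

text \<open>
  Reduction modulo \<open>\<Gamma>\<close>. An infinite value is sent to the empty set, which is not an element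
  of \<open>\<real>/\<Gamma>\<close>; hence an equation between \<open>real_mod \<Gamma> x\<close> and a coset says in
  particular that \<open>x\<close> is finite.
\<close>

definition real_mod :: "real set \<Rightarrow> ereal \<Rightarrow> real set" where
  "real_mod \<Gamma> x = (case x of ereal t \<Rightarrow> \<Gamma> #>\<^bsub>real_add_group\<^esub> t | _ \<Rightarrow> {})"

text \<open>
  A relation rather than a function: \<open>B\<close> is the barcode read off from some singular value
  decomposition of \<open>d (k + 1)\<close>, viewed as a map to the cycles in degree \<open>k\<close>. List positions
  count from zero.
\<close>

definition concise_barcode ::
  "('k, 'm) ring_scheme \<Rightarrow> real set \<Rightarrow> (int \<Rightarrow> (real \<Rightarrow> 'k, 'c, 'n) module_scheme)
    \<Rightarrow> (int \<Rightarrow> 'c \<Rightarrow> 'c) \<Rightarrow> (int \<Rightarrow> 'c \<Rightarrow> ereal) \<Rightarrow> int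
    \<Rightarrow> (real set \<times> ereal) multiset \<Rightarrow> bool" where
  "concise_barcode K \<Gamma> C d l k B \<longleftrightarrow>
     (\<exists>ys xs. singular_value_decomposition K \<Gamma> (C (k + 1)) (l (k + 1))
                (cycle_space C d k) (l k) (d (k + 1)) ys xs \<and>
        (let r = map_rank (novikov_field K \<Gamma>) (C (k + 1)) (cycle_space C d k) (d (k + 1)) in
           B = mset [(real_mod \<Gamma> (l k (xs ! i)), l (k + 1) (ys ! i) - l k (xs ! i)).
                       i \<leftarrow> [0..<r], l k (xs ! i) < l (k + 1) (ys ! i)]
             + mset [(real_mod \<Gamma> (l k x), \<infinity>). x \<leftarrow> drop r xs]))"

end

theory Submission
  imports Defs
begin

text \<open>
  In a singular value decomposition the basis of the cycles is an orthogonal list \<open>us @ ws\<close>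
  whose leading part \<open>us\<close> is a basis of the boundaries. By orthogonality, adding a boundary
  to a combination of \<open>ws\<close> cannot lower its filtration level, so every homology class has
  exactly one representative in the span of \<open>ws\<close>, and this one realises the spectral
  invariant. Hence the classes of \<open>ws\<close> are the required basis and inherit the orthogonality
  of \<open>ws\<close>. The maximum in (ii) is attained at a coefficient whose valuation lies in
  \<open>\<Gamma>\<close>, so it does not change the residue modulo \<open>\<Gamma>\<close>.
\<close>

section \<open>Linear combinations and bases indexed by list positions\<close>

text \<open>\<open>lincomb\<close> is indexed by the vectors of a set, orthogonality by positions in
  a list. Distinctness makes \<open>(!) ws\<close> injective on positions, so one sum is a
  reindexing of the other.\<close>

lemma (in Module.module) lincomb_set_nth:
  assumes "distinct ws" and "set ws \<subseteq> carrier M" and "a \<in> set ws \<rightarrow> carrier R"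
  shows "lincomb a (set ws) = (\<Oplus>\<^bsub>M\<^esub>i\<in>{..<length ws}. a (ws ! i) \<odot>\<^bsub>M\<^esub> ws ! i)"
proof -
  have img: "set ws = (!) ws ` {..<length ws}" by (auto simp: in_set_conv_nth)
  have "lincomb a (set ws) = (\<Oplus>\<^bsub>M\<^esub>v\<in>(!) ws ` {..<length ws}. a v \<odot>\<^bsub>M\<^esub> v)"
    unfolding lincomb_def by (simp flip: img)
  also have "\<dots> = (\<Oplus>\<^bsub>M\<^esub>i\<in>{..<length ws}. a (ws ! i) \<odot>\<^bsub>M\<^esub> ws ! i)"
    using assms by (intro M.finsum_reindex) (auto simp: img[symmetric] inj_on_def nth_eq_iff_index_eq)
  finally show ?thesis .
qed

lemma (in Module.module) in_span_nth:
  assumes "distinct ws" and "set ws \<subseteq> carrier M" and "v \<in> span (set ws)"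
  obtains c where "\<And>i. i < length ws \<Longrightarrow> c i \<in> carrier R"
    and "v = (\<Oplus>\<^bsub>M\<^esub>i\<in>{..<length ws}. c i \<odot>\<^bsub>M\<^esub> ws ! i)"
proof -
  obtain a where a: "a \<in> set ws \<rightarrow> carrier R" "lincomb a (set ws) = v"
    using finite_in_span[OF _ assms(2,3)] by auto
  show ?thesis
    by (rule that[of "\<lambda>i. a (ws ! i)"]) (use a lincomb_set_nth[OF assms(1,2) a(1)] in auto)
qed

text \<open>Independence is asked of positions rather than of vectors, so it also excludes repeated
  entries. This form suits a list of cosets, whose entries are not known beforehand to
  differ.\<close>

lemma (in vectorspace) ordered_basisI:
  assumes ws: "set ws \<subseteq> carrier V"
    and indpt: "\<And>c j. (\<And>i. i < length ws \<Longrightarrow> c i \<in> carrier K) \<Longrightarrow>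
      (\<Oplus>\<^bsub>V\<^esub>i\<in>{..<length ws}. c i \<odot>\<^bsub>V\<^esub> ws ! i) = \<zero>\<^bsub>V\<^esub> \<Longrightarrow> j < length ws \<Longrightarrow> c j = \<zero>\<^bsub>K\<^esub>"
    and gen: "\<And>v. v \<in> carrier V \<Longrightarrow> \<exists>c. (\<forall>i<length ws. c i \<in> carrier K) \<and>
      v = (\<Oplus>\<^bsub>V\<^esub>i\<in>{..<length ws}. c i \<odot>\<^bsub>V\<^esub> ws ! i)"
  shows "ordered_basis K V ws"
proof -
  have mem: "ws ! i \<in> carrier V" if "i < length ws" for i using that ws by (auto simp: subset_iff)
  have dist: "distinct ws"
  proof (rule ccontr)
    assume "\<not> distinct ws"
    then obtain i j where ij: "i < length ws" "j < length ws" "i \<noteq> j" "ws ! i = ws ! j"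
      by (auto simp: distinct_conv_nth)
    \<comment> \<open>The relation saying that the difference of the two equal entries vanishes; its
      coefficient at \<open>i\<close> is one.\<close>
    define c where "c = (\<lambda>n. if n = i then \<one>\<^bsub>K\<^esub> else if n = j then \<ominus>\<^bsub>K\<^esub> \<one>\<^bsub>K\<^esub> else \<zero>\<^bsub>K\<^esub>)"
    have c: "c n \<in> carrier K" for n by (simp add: c_def)
    have "(\<Oplus>\<^bsub>V\<^esub>n\<in>{..<length ws}. c n \<odot>\<^bsub>V\<^esub> ws ! n) = (\<Oplus>\<^bsub>V\<^esub>n\<in>{i, j}. c n \<odot>\<^bsub>V\<^esub> ws ! n)"
      using ij c mem
      by (intro M.add.finprod_mono_neutral_cong_right) (auto simp: c_def)
    also have "\<dots> = ws ! i \<oplus>\<^bsub>V\<^esub> (\<ominus>\<^bsub>K\<^esub> \<one>\<^bsub>K\<^esub>) \<odot>\<^bsub>V\<^esub> ws ! i"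
      using ij mem by (simp add: c_def)
    also have "\<dots> = \<zero>\<^bsub>V\<^esub>" using mem[OF ij(1)] by (simp add: smult_minus_1 M.r_neg)
    finally have "c i = \<zero>\<^bsub>K\<^esub>" using indpt[of c i] c ij(1) by blast
    then show False by (simp add: c_def)
  qed
  have "lin_indpt (set ws)"
  proof (rule finite_lin_indpt2)
    fix a assume a: "a \<in> set ws \<rightarrow> carrier K" "lincomb a (set ws) = \<zero>\<^bsub>V\<^esub>"
    have "a (ws ! j) = \<zero>\<^bsub>K\<^esub>" if "j < length ws" for j
      by (rule indpt[of "\<lambda>i. a (ws ! i)"])
        (use a lincomb_set_nth[OF dist ws a(1)] that in auto)
    then show "\<forall>v\<in>set ws. a v = \<zero>\<^bsub>K\<^esub>" by (auto simp: in_set_conv_nth)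
  qed (use ws in auto)
  moreover have "carrier V \<subseteq> span (set ws)"
  proof
    fix v assume "v \<in> carrier V"
    then obtain c where c: "\<And>i. i < length ws \<Longrightarrow> c i \<in> carrier K"
      and v: "v = (\<Oplus>\<^bsub>V\<^esub>i\<in>{..<length ws}. c i \<odot>\<^bsub>V\<^esub> ws ! i)" using gen by blast
    have sub: "submodule K (span (set ws)) V" using ws by (rule span_is_submodule)
    \<comment> \<open>The sum runs over positions and is not literally a \<open>lincomb\<close>, so
      membership in the span is built up along initial segments.\<close>
    have "(\<Oplus>\<^bsub>V\<^esub>i\<in>{..<n}. c i \<odot>\<^bsub>V\<^esub> ws ! i) \<in> span (set ws)" if "n \<le> length ws" for n
      using that
    proof (induction n)
      case 0
      show ?case using submodule.zero_closed[OF sub] by simp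
    next
      case (Suc n)
      have "ws ! n \<in> span (set ws)" using Suc.prems in_own_span[OF ws] by (auto simp: subset_iff)
      then have "c n \<odot>\<^bsub>V\<^esub> ws ! n \<in> span (set ws)"
        using Suc.prems c submodule.smult_closed[OF sub] by simp
      moreover have "(\<Oplus>\<^bsub>V\<^esub>i\<in>{..<Suc n}. c i \<odot>\<^bsub>V\<^esub> ws ! i) =
          c n \<odot>\<^bsub>V\<^esub> ws ! n \<oplus>\<^bsub>V\<^esub> (\<Oplus>\<^bsub>V\<^esub>i\<in>{..<n}. c i \<odot>\<^bsub>V\<^esub> ws ! i)"
        unfolding lessThan_Suc using Suc.prems c mem by (intro M.finsum_insert) auto
      ultimately show ?case using Suc submodule.m_closed[OF sub] by simp
    qed
    then show "v \<in> span (set ws)" unfolding v by blast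
  qed
  ultimately show ?thesis
    unfolding ordered_basis_def basis_def using dist ws span_is_subset2[OF ws] by auto
qed

section \<open>Quotients of a vector space by a subspace\<close>

locale quotient_vectorspace = vectorspace F V
  for F :: "('a, 'm) ring_scheme" and V :: "('a, 'v, 'n) module_scheme" +
  fixes N :: "'v set"
  assumes sub: "submodule F N V"
begin

sublocale N: abelian_subgroup N V
proof (rule abelian_subgroupI3)
  show "additive_subgroup N V"
  proof (rule additive_subgroup.intro, rule M.add.subgroupI)
    show "N \<subseteq> carrier V" by (rule submodule.subset[OF sub])
    show "N \<noteq> {}" using submodule.zero_closed[OF sub] by blast
    fix a b assume a: "a \<in> N" and b: "b \<in> N"
    show "a \<oplus>\<^bsub>V\<^esub> b \<in> N" using submodule.m_closed[OF sub a b] .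
    \<comment> \<open>Closure under negation comes from closure under the scalar minus one.\<close>
    have "(\<ominus>\<^bsub>F\<^esub> \<one>\<^bsub>F\<^esub>) \<odot>\<^bsub>V\<^esub> a \<in> N" using submodule.smult_closed[OF sub _ a] by simp
    then show "\<ominus>\<^bsub>V\<^esub> a \<in> N" using a submodule.subset[OF sub] by (auto simp: smult_minus_1)
  qed
qed (rule M.abelian_group_axioms)

abbreviation Q where "Q \<equiv> quotient_module V N"

abbreviation proj where "proj x \<equiv> N +>\<^bsub>V\<^esub> x"

lemma proj_eq_iff:
  assumes "x \<in> carrier V" "y \<in> carrier V"
  shows "proj x = proj y \<longleftrightarrow> (\<exists>b\<in>N. x = b \<oplus>\<^bsub>V\<^esub> y)"
proof
  assume "proj x = proj y"
  then have "x \<in> proj y" using N.a_rcos_self[OF assms(1)] by simp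
  then show "\<exists>b\<in>N. x = b \<oplus>\<^bsub>V\<^esub> y" by (auto simp: a_r_coset_def')
next
  assume "\<exists>b\<in>N. x = b \<oplus>\<^bsub>V\<^esub> y"
  then have "x \<in> proj y" by (auto simp: a_r_coset_def')
  then show "proj x = proj y" using N.a_repr_independence' assms by metis
qed

lemma carrier_Q: "carrier Q = proj ` carrier V"
  by (auto simp: quotient_module_def A_RCOSETS_def')

lemma carrier_QE:
  assumes "v \<in> carrier Q"
  obtains x where "x \<in> carrier V" and "v = proj x"
  using assms by (auto simp: carrier_Q)

lemma proj_in_Q: "x \<in> carrier V \<Longrightarrow> proj x \<in> carrier Q"
  by (simp add: carrier_Q)

lemma zero_Q: "\<zero>\<^bsub>Q\<^esub> = proj \<zero>\<^bsub>V\<^esub>"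
  using M.a_coset_add_zero[OF N.a_subset] by (simp add: quotient_module_def)

lemma add_Q: "x \<in> carrier V \<Longrightarrow> y \<in> carrier V \<Longrightarrow> proj x \<oplus>\<^bsub>Q\<^esub> proj y = proj (x \<oplus>\<^bsub>V\<^esub> y)"
  by (simp add: quotient_module_def N.a_rcos_sum)

text \<open>This is well-definedness of the scalar action: representatives of a coset differ by an
  element of \<open>N\<close>, and \<open>N\<close> is stable under scalars, so all members of the
  defining union coincide. The union is not empty because \<open>x\<close> lies in its own
  coset.\<close>

lemma smult_Q:
  assumes "a \<in> carrier F" "x \<in> carrier V"
  shows "a \<odot>\<^bsub>Q\<^esub> proj x = proj (a \<odot>\<^bsub>V\<^esub> x)"
proof -
  have "proj (a \<odot>\<^bsub>V\<^esub> y) = proj (a \<odot>\<^bsub>V\<^esub> x)" if "y \<in> proj x" for y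
  proof -
    obtain b where b: "b \<in> N" "y = b \<oplus>\<^bsub>V\<^esub> x" using \<open>y \<in> proj x\<close> by (auto simp: a_r_coset_def')
    have "b \<in> carrier V" using b(1) N.a_subset by blast
    then have "a \<odot>\<^bsub>V\<^esub> y = a \<odot>\<^bsub>V\<^esub> b \<oplus>\<^bsub>V\<^esub> a \<odot>\<^bsub>V\<^esub> x" using b assms by (simp add: smult_r_distr)
    moreover have "a \<odot>\<^bsub>V\<^esub> b \<in> N" using submodule.smult_closed[OF sub assms(1) b(1)] .
    ultimately show ?thesis using proj_eq_iff assms \<open>b \<in> carrier V\<close> b(2) by auto
  qed
  then have "(\<Union>y\<in>proj x. proj (a \<odot>\<^bsub>V\<^esub> y)) = (\<Union>y\<in>proj x. proj (a \<odot>\<^bsub>V\<^esub> x))"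
    by (intro SUP_cong) simp_all
  also have "\<dots> = proj (a \<odot>\<^bsub>V\<^esub> x)"
    using N.a_rcos_self[OF assms(2)] by (intro SUP_const) blast
  finally show ?thesis by (simp add: quotient_module_def)
qed

text \<open>Every element of \<open>Q\<close> is some \<open>proj x\<close>, and \<open>proj\<close>
  commutes with the operations, so each axiom is the image of the corresponding one in
  \<open>V\<close>.\<close>

lemma quotient_vectorspace: "vectorspace F Q"
proof -
  have neg: "\<exists>w\<in>carrier Q. v \<oplus>\<^bsub>Q\<^esub> w = \<zero>\<^bsub>Q\<^esub>" if v: "v \<in> carrier Q" for v
  proof -
    obtain x where x: "x \<in> carrier V" "v = proj x" using v by (rule carrier_QE)
    have "v \<oplus>\<^bsub>Q\<^esub> proj (\<ominus>\<^bsub>V\<^esub> x) = \<zero>\<^bsub>Q\<^esub>" using x by (simp add: add_Q zero_Q M.r_neg)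
    then show ?thesis using x proj_in_Q[of "\<ominus>\<^bsub>V\<^esub> x"] by auto
  qed
  have comm: "v \<oplus>\<^bsub>Q\<^esub> w = w \<oplus>\<^bsub>Q\<^esub> v" if "v \<in> carrier Q" "w \<in> carrier Q" for v w
    using that by (elim carrier_QE) (simp only: add_Q M.a_comm)
  have assoc: "v \<oplus>\<^bsub>Q\<^esub> w \<oplus>\<^bsub>Q\<^esub> x = v \<oplus>\<^bsub>Q\<^esub> (w \<oplus>\<^bsub>Q\<^esub> x)"
    if "v \<in> carrier Q" "w \<in> carrier Q" "x \<in> carrier Q" for v w x
    using that by (elim carrier_QE) (simp only: add_Q M.a_closed M.a_assoc)
  have smult: "a \<odot>\<^bsub>Q\<^esub> v \<in> carrier Q" "\<one>\<^bsub>F\<^esub> \<odot>\<^bsub>Q\<^esub> v = v"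
    "(a \<otimes>\<^bsub>F\<^esub> b) \<odot>\<^bsub>Q\<^esub> v = a \<odot>\<^bsub>Q\<^esub> (b \<odot>\<^bsub>Q\<^esub> v)"
    "(a \<oplus>\<^bsub>F\<^esub> b) \<odot>\<^bsub>Q\<^esub> v = a \<odot>\<^bsub>Q\<^esub> v \<oplus>\<^bsub>Q\<^esub> b \<odot>\<^bsub>Q\<^esub> v"
    if "a \<in> carrier F" "b \<in> carrier F" "v \<in> carrier Q" for a b v
    using that by (auto elim!: carrier_QE simp: proj_in_Q add_Q smult_Q smult_assoc1 smult_l_distr)
  have add: "v \<oplus>\<^bsub>Q\<^esub> w \<in> carrier Q"
    "a \<odot>\<^bsub>Q\<^esub> (v \<oplus>\<^bsub>Q\<^esub> w) = a \<odot>\<^bsub>Q\<^esub> v \<oplus>\<^bsub>Q\<^esub> a \<odot>\<^bsub>Q\<^esub> w"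
    if "a \<in> carrier F" "v \<in> carrier Q" "w \<in> carrier Q" for a v w
    using that by (auto elim!: carrier_QE simp: proj_in_Q add_Q smult_Q smult_r_distr)
  have zero_in: "\<zero>\<^bsub>Q\<^esub> \<in> carrier Q" by (simp add: zero_Q proj_in_Q)
  have zero: "v \<oplus>\<^bsub>Q\<^esub> \<zero>\<^bsub>Q\<^esub> = v" if "v \<in> carrier Q" for v
    using that by (auto elim!: carrier_QE simp: proj_in_Q zero_Q add_Q)
  show ?thesis
    \<comment> \<open>The bundled facts share their premises; where a goal offers no scalar,
      \<open>R.zero_closed\<close> supplies zero.\<close>
    by (rule vs_criteria; (intro allI impI ballI)?; (elim conjE)?;
      (rule field_axioms zero_in neg comm assoc smult add zero; (assumption | rule R.zero_closed)+)?)
qed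

text \<open>Linearity of \<open>proj\<close> for finite sums, by induction on initial segments. It
  turns relations and expansions among cosets into statements about representatives.\<close>

lemma finsum_Q:
  assumes "set ws \<subseteq> carrier V" "\<And>i. i < length ws \<Longrightarrow> c i \<in> carrier F"
  shows "(\<Oplus>\<^bsub>Q\<^esub>i\<in>{..<length ws}. c i \<odot>\<^bsub>Q\<^esub> map proj ws ! i) =
    proj (\<Oplus>\<^bsub>V\<^esub>i\<in>{..<length ws}. c i \<odot>\<^bsub>V\<^esub> ws ! i)"
proof -
  interpret Q: vectorspace F Q by (rule quotient_vectorspace)
  have mem: "ws ! i \<in> carrier V" if "i < length ws" for i using that assms(1) by (auto simp: subset_iff)
  have "proj (\<Oplus>\<^bsub>V\<^esub>i\<in>{..<n}. c i \<odot>\<^bsub>V\<^esub> ws ! i) =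
      (\<Oplus>\<^bsub>Q\<^esub>i\<in>{..<n}. proj (c i \<odot>\<^bsub>V\<^esub> ws ! i))" if "n \<le> length ws" for n
    using that
  proof (induction n)
    case (Suc n)
    have "(\<Oplus>\<^bsub>V\<^esub>i\<in>{..<Suc n}. c i \<odot>\<^bsub>V\<^esub> ws ! i) =
        c n \<odot>\<^bsub>V\<^esub> ws ! n \<oplus>\<^bsub>V\<^esub> (\<Oplus>\<^bsub>V\<^esub>i\<in>{..<n}. c i \<odot>\<^bsub>V\<^esub> ws ! i)"
      unfolding lessThan_Suc using Suc.prems assms(2) mem by (intro M.finsum_insert) auto
    moreover have "(\<Oplus>\<^bsub>Q\<^esub>i\<in>{..<Suc n}. proj (c i \<odot>\<^bsub>V\<^esub> ws ! i)) =
        proj (c n \<odot>\<^bsub>V\<^esub> ws ! n) \<oplus>\<^bsub>Q\<^esub> (\<Oplus>\<^bsub>Q\<^esub>i\<in>{..<n}. proj (c i \<odot>\<^bsub>V\<^esub> ws ! i))"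
      unfolding lessThan_Suc using Suc.prems assms(2) mem proj_in_Q by (intro Q.M.finsum_insert) auto
    moreover have "c n \<odot>\<^bsub>V\<^esub> ws ! n \<in> carrier V" using Suc.prems assms(2) mem by simp
    moreover have "(\<Oplus>\<^bsub>V\<^esub>i\<in>{..<n}. c i \<odot>\<^bsub>V\<^esub> ws ! i) \<in> carrier V"
      using Suc.prems assms(2) mem by (intro M.finsum_closed) auto
    ultimately show ?case using Suc by (simp flip: add_Q)
  qed (simp add: zero_Q)
  from this[of "length ws"] have "proj (\<Oplus>\<^bsub>V\<^esub>i\<in>{..<length ws}. c i \<odot>\<^bsub>V\<^esub> ws ! i) =
      (\<Oplus>\<^bsub>Q\<^esub>i\<in>{..<length ws}. proj (c i \<odot>\<^bsub>V\<^esub> ws ! i))" by simp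
  also have "\<dots> = (\<Oplus>\<^bsub>Q\<^esub>i\<in>{..<length ws}. c i \<odot>\<^bsub>Q\<^esub> map proj ws ! i)"
    using assms mem by (intro Q.M.finsum_cong') (simp_all add: Pi_iff proj_in_Q flip: smult_Q)
  finally show ?thesis by simp
qed

end

section \<open>Valuations and residues modulo \<Gamma>\<close>

text \<open>A least element of a set of reals need not exist. Here the support is finite below any
  bound, so its least exponent is attained, and the support lies in \<Gamma>.\<close>

lemma novikov_val_in:
  assumes "c \<in> carrier (novikov_field K \<Gamma>)" and "c \<noteq> \<zero>\<^bsub>novikov_field K \<Gamma>\<^esub>"
  obtains g where "g \<in> \<Gamma>" and "novikov_val K c = ereal g"
proof -
  obtain g0 where g0: "c g0 \<noteq> \<zero>\<^bsub>K\<^esub>" using assms(2) by (auto simp: novikov_field_def)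
  \<comment> \<open>The bound exceeds \<open>g0\<close> so that the strict inequality keeps
    \<open>g0\<close> itself in the set, which is thus nonempty.\<close>
  let ?A = "{g. g < g0 + 1 \<and> c g \<noteq> \<zero>\<^bsub>K\<^esub>}"
  have fin: "finite ?A" using assms(1) by (simp add: novikov_field_def novikov_carrier_def)
  have ne: "g0 \<in> ?A" using g0 by simp
  have min: "c (Min ?A) \<noteq> \<zero>\<^bsub>K\<^esub>" using Min_in[OF fin] ne by blast
  have "(LEAST g. c g \<noteq> \<zero>\<^bsub>K\<^esub>) = Min ?A"
  proof (rule Least_equality, rule min)
    fix g assume "c g \<noteq> \<zero>\<^bsub>K\<^esub>"
    then show "Min ?A \<le> g"
      using Min_le[OF fin, of g] Min_le[OF fin ne] by (cases "g < g0 + 1") auto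
  qed
  moreover have "Min ?A \<in> \<Gamma>"
    using min assms(1) by (auto simp: novikov_field_def novikov_carrier_def)
  ultimately show ?thesis using that g0 unfolding novikov_val_def by metis
qed

lemma subgroup_realD:
  assumes "subgroup \<Gamma> real_add_group"
  shows "x \<in> \<Gamma> \<Longrightarrow> y \<in> \<Gamma> \<Longrightarrow> x + y \<in> \<Gamma>" and "x \<in> \<Gamma> \<Longrightarrow> - x \<in> \<Gamma>"
proof -
  have "group real_add_group"
    by (rule groupI) (auto simp: real_add_group_def intro: exI[of _ "- x" for x])
  then have "inv\<^bsub>real_add_group\<^esub> x = - x"
    by (rule group.inv_equality) (auto simp: real_add_group_def)
  then show "x \<in> \<Gamma> \<Longrightarrow> - x \<in> \<Gamma>" using subgroup.m_inv_closed[OF assms, of x] by simp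
  show "x \<in> \<Gamma> \<Longrightarrow> y \<in> \<Gamma> \<Longrightarrow> x + y \<in> \<Gamma>"
    using subgroup.m_closed[OF assms] by (simp add: real_add_group_def)
qed

text \<open>Translation by \<open>g\<close> permutes \<Gamma>, so both sides are the same coset; for
  infinite \<open>x\<close> both are empty, as \<open>g\<close> is finite.\<close>

lemma real_mod_diff:
  assumes \<Gamma>: "subgroup \<Gamma> real_add_group" and g: "g \<in> \<Gamma>"
  shows "real_mod \<Gamma> (x - ereal g) = real_mod \<Gamma> x"
proof (cases x)
  case (real t)
  have "(\<lambda>h. h + (t - g)) ` \<Gamma> = (\<lambda>h. h + t) ` \<Gamma>"
  proof (intro equalityI subsetI; elim imageE)
    fix y h assume "h \<in> \<Gamma>" "y = h + (t - g)"
    then show "y \<in> (\<lambda>h. h + t) ` \<Gamma>"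
      using subgroup_realD(1)[OF \<Gamma> _ subgroup_realD(2)[OF \<Gamma> g], of h]
      by (intro image_eqI[of _ _ "h + - g"]) auto
  next
    fix y h assume "h \<in> \<Gamma>" "y = h + t"
    then show "y \<in> (\<lambda>h. h + (t - g)) ` \<Gamma>"
      using subgroup_realD[OF \<Gamma>] g by (intro image_eqI[of _ _ "h + g"]) auto
  qed
  then show ?thesis
    using real by (auto simp: real_mod_def r_coset_def real_add_group_def)
qed (auto simp: real_mod_def)

section \<open>Orthogonal families in a normed space\<close>

context nonarch_normed_space
begin

sublocale vectorspace "novikov_field K \<Gamma>" V by (rule vectorspace)

lemma norm_zero: "l \<zero>\<^bsub>V\<^esub> = - \<infinity>"
  using eq_MInf_iff[of "\<zero>\<^bsub>V\<^esub>"] by simp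

text \<open>The norm axioms quantify over elements of the carrier and hence restrict. This gives the
  cycles the filtration of the chain space.\<close>

lemma nonarch_normed_subspace:
  assumes "submodule (novikov_field K \<Gamma>) W V"
  shows "nonarch_normed_space K \<Gamma> (V\<lparr>carrier := W\<rparr>) l"
proof -
  have "x \<in> carrier V" if "x \<in> W" for x using submodule.subset[OF assms] that by blast
  moreover have "vectorspace (novikov_field K \<Gamma>) (V\<lparr>carrier := W\<rparr>)"
    by (rule subspace_is_vs) (use assms vectorspace in \<open>simp add: VectorSpace.subspace_def\<close>)
  ultimately show ?thesis
    unfolding nonarch_normed_space_def
    using not_PInf eq_MInf_iff smult ultrametric by simp
qed

text \<open>Orthogonality is applied to the concatenation \<open>e\<close> of the two coefficient
  families, and the index range is cut at \<open>length us\<close>; the supremum over the two pieces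
  is the maximum of the two suprema.\<close>

lemma orthogonal_append:
  assumes orth: "orthogonal_family K \<Gamma> V l (us @ ws)"
    and b: "\<And>i. i < length us \<Longrightarrow> b i \<in> carrier (novikov_field K \<Gamma>)"
    and c: "\<And>j. j < length ws \<Longrightarrow> c j \<in> carrier (novikov_field K \<Gamma>)"
  shows "l ((\<Oplus>\<^bsub>V\<^esub>i\<in>{..<length us}. b i \<odot>\<^bsub>V\<^esub> us ! i) \<oplus>\<^bsub>V\<^esub> (\<Oplus>\<^bsub>V\<^esub>j\<in>{..<length ws}. c j \<odot>\<^bsub>V\<^esub> ws ! j)) =
    max (SUP i\<in>{..<length us}. l (b i \<odot>\<^bsub>V\<^esub> us ! i)) (SUP j\<in>{..<length ws}. l (c j \<odot>\<^bsub>V\<^esub> ws ! j))"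
proof -
  let ?m = "length us" and ?n = "length ws"
  define e where "e i = (if i < ?m then b i else c (i - ?m))" for i
  let ?t = "\<lambda>i. e i \<odot>\<^bsub>V\<^esub> (us @ ws) ! i"
  have car: "set (us @ ws) \<subseteq> carrier V" using orth by (simp add: orthogonal_family_def)
  have us: "us ! i \<in> carrier V" if "i < ?m" for i using car that by (auto simp: subset_iff)
  have ws: "ws ! j \<in> carrier V" if "j < ?n" for j using car that by (auto simp: subset_iff)
  have e: "e i \<in> carrier (novikov_field K \<Gamma>)" if "i < ?m + ?n" for i
    using that b c by (auto simp: e_def)
  have split: "{..<?m + ?n} = {..<?m} \<union> (\<lambda>j. ?m + j) ` {..<?n}"
  proof (intro equalityI subsetI)
    fix i assume "i \<in> {..<?m + ?n}"
    then show "i \<in> {..<?m} \<union> (\<lambda>j. ?m + j) ` {..<?n}"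
      by (cases "i < ?m") (auto intro: image_eqI[of _ _ "i - ?m"])
  qed auto
  have t: "?t i \<in> carrier V" if "i < ?m + ?n" for i
    using e[OF that] that us ws by (auto simp: nth_append)
  have tl: "?t i = b i \<odot>\<^bsub>V\<^esub> us ! i" if "i < ?m" for i using that by (simp add: e_def nth_append)
  have tr: "?t (?m + j) = c j \<odot>\<^bsub>V\<^esub> ws ! j" for j by (simp add: e_def nth_append)
  have "(\<Oplus>\<^bsub>V\<^esub>i\<in>{..<?m + ?n}. ?t i) =
      (\<Oplus>\<^bsub>V\<^esub>i\<in>{..<?m}. ?t i) \<oplus>\<^bsub>V\<^esub> (\<Oplus>\<^bsub>V\<^esub>i\<in>(\<lambda>j. ?m + j) ` {..<?n}. ?t i)"
    unfolding split by (intro M.finsum_Un_disjoint Pi_I t) auto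
  also have "(\<Oplus>\<^bsub>V\<^esub>i\<in>{..<?m}. ?t i) = (\<Oplus>\<^bsub>V\<^esub>i\<in>{..<?m}. b i \<odot>\<^bsub>V\<^esub> us ! i)"
    using tl us b by (intro M.finsum_cong') auto
  also have "(\<Oplus>\<^bsub>V\<^esub>i\<in>(\<lambda>j. ?m + j) ` {..<?n}. ?t i) = (\<Oplus>\<^bsub>V\<^esub>j\<in>{..<?n}. ?t (?m + j))"
    by (rule M.finsum_reindex, intro Pi_I t) (auto simp: inj_on_def)
  also have "\<dots> = (\<Oplus>\<^bsub>V\<^esub>j\<in>{..<?n}. c j \<odot>\<^bsub>V\<^esub> ws ! j)" by (simp only: tr)
  finally have "l ((\<Oplus>\<^bsub>V\<^esub>i\<in>{..<?m}. b i \<odot>\<^bsub>V\<^esub> us ! i) \<oplus>\<^bsub>V\<^esub> (\<Oplus>\<^bsub>V\<^esub>j\<in>{..<?n}. c j \<odot>\<^bsub>V\<^esub> ws ! j)) =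
      l (\<Oplus>\<^bsub>V\<^esub>i\<in>{..<?m + ?n}. ?t i)" by simp
  also have "\<dots> = (SUP i\<in>{..<?m + ?n}. l (?t i))"
    using orth e unfolding orthogonal_family_def by simp
  also have "\<dots> = sup (SUP i\<in>{..<?m}. l (?t i)) (SUP j\<in>{..<?n}. l (?t (?m + j)))"
    unfolding split by (simp only: SUP_union image_image)
  also have "(SUP i\<in>{..<?m}. l (?t i)) = (SUP i\<in>{..<?m}. l (b i \<odot>\<^bsub>V\<^esub> us ! i))"
    using tl by (intro SUP_cong) auto
  finally show ?thesis by (simp only: tr sup_max)
qed

text \<open>The level of a sum of a \<open>us\<close>-part and a \<open>ws\<close>-part is the
  maximum of the two levels, so it is at least that of the \<open>ws\<close>-part. The first claim
  is the case where the \<open>us\<close>-part has zero coefficients.\<close>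

lemma orthogonal_append_minimal:
  assumes orth: "orthogonal_family K \<Gamma> V l (us @ ws)" and dist: "distinct us"
    and c: "\<And>j. j < length ws \<Longrightarrow> c j \<in> carrier (novikov_field K \<Gamma>)"
    and b: "b \<in> span (set us)"
  shows "l (\<Oplus>\<^bsub>V\<^esub>j\<in>{..<length ws}. c j \<odot>\<^bsub>V\<^esub> ws ! j) = (SUP j\<in>{..<length ws}. l (c j \<odot>\<^bsub>V\<^esub> ws ! j))"
    and "l (\<Oplus>\<^bsub>V\<^esub>j\<in>{..<length ws}. c j \<odot>\<^bsub>V\<^esub> ws ! j) \<le>
      l (b \<oplus>\<^bsub>V\<^esub> (\<Oplus>\<^bsub>V\<^esub>j\<in>{..<length ws}. c j \<odot>\<^bsub>V\<^esub> ws ! j))"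
proof -
  let ?x = "\<Oplus>\<^bsub>V\<^esub>j\<in>{..<length ws}. c j \<odot>\<^bsub>V\<^esub> ws ! j"
  have car: "set us \<subseteq> carrier V" "set ws \<subseteq> carrier V"
    using orth by (auto simp: orthogonal_family_def)
  have us: "us ! i \<in> carrier V" if "i < length us" for i using car(1) that by (auto simp: subset_iff)
  have ws: "ws ! i \<in> carrier V" if "i < length ws" for i using car(2) that by (auto simp: subset_iff)
  have x: "?x \<in> carrier V" using ws c by (intro M.finsum_closed) auto
  \<comment> \<open>With zero coefficients the \<open>us\<close>-part contributes the zero vector to
    the sum and \<open>- \<infinity>\<close>, neutral for \<open>max\<close>, to the level; this
    includes empty \<open>us\<close>.\<close>
  have "(\<Oplus>\<^bsub>V\<^esub>i\<in>{..<length us}. \<zero>\<^bsub>novikov_field K \<Gamma>\<^esub> \<odot>\<^bsub>V\<^esub> us ! i) = \<zero>\<^bsub>V\<^esub>"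
    using us by (intro M.add.finprod_one_eqI) auto
  moreover have "(SUP i\<in>{..<length us}. l (\<zero>\<^bsub>novikov_field K \<Gamma>\<^esub> \<odot>\<^bsub>V\<^esub> us ! i)) = - \<infinity>"
    using us by (intro antisym SUP_least) (auto simp: norm_zero)
  ultimately show eq: "l ?x = (SUP j\<in>{..<length ws}. l (c j \<odot>\<^bsub>V\<^esub> ws ! j))"
    using orthogonal_append[OF orth, of "\<lambda>_. \<zero>\<^bsub>novikov_field K \<Gamma>\<^esub>" c] c x by simp
  obtain a where a: "\<And>i. i < length us \<Longrightarrow> a i \<in> carrier (novikov_field K \<Gamma>)"
    and b_eq: "b = (\<Oplus>\<^bsub>V\<^esub>i\<in>{..<length us}. a i \<odot>\<^bsub>V\<^esub> us ! i)"
    using in_span_nth[OF dist car(1) b] by blast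
  show "l ?x \<le> l (b \<oplus>\<^bsub>V\<^esub> ?x)"
    unfolding b_eq eq by (subst orthogonal_append[OF orth]) (simp_all add: a c)
qed

end

section \<open>The quotient norm and an orthogonal basis of the quotient\<close>

text \<open>The usual quotient seminorm in filtration form. For the cycles modulo the boundaries it
  is the spectral invariant.\<close>

definition quotient_norm :: "('a, 'v, 'n) module_scheme \<Rightarrow> 'v set \<Rightarrow> ('v \<Rightarrow> ereal) \<Rightarrow> 'v set \<Rightarrow> ereal" where
  "quotient_norm V N l \<alpha> = Inf {l x | x. x \<in> carrier V \<and> N +>\<^bsub>V\<^esub> x = \<alpha>}"

text \<open>The data that a singular value decomposition of the differential into the cycles leaves
  on its target: \<open>V\<close> will be the cycles, \<open>N\<close> the boundaries,
  \<open>us\<close> the first \<open>r\<close> target vectors and \<open>ws\<close> the remaining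
  ones.\<close>

locale orthogonal_quotient = nonarch_normed_space K \<Gamma> V l
  for K :: "('k, 'm) ring_scheme" and \<Gamma> :: "real set"
    and V :: "(real \<Rightarrow> 'k, 'v, 'n) module_scheme" and l :: "'v \<Rightarrow> ereal" +
  fixes N :: "'v set" and us ws :: "'v list"
  assumes submodule: "LinearCombinations.submodule (novikov_field K \<Gamma>) N V"
    and basis: "orthogonal_basis K \<Gamma> V l (us @ ws)"
    and subspace_basis: "ordered_basis (novikov_field K \<Gamma>) (V\<lparr>carrier := N\<rparr>) us"
begin

sublocale quotient_vectorspace "novikov_field K \<Gamma>" V N
  by (intro quotient_vectorspace.intro quotient_vectorspace_axioms.intro vectorspace submodule)

abbreviation \<Lambda> where "\<Lambda> \<equiv> novikov_field K \<Gamma>"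

abbreviation \<rho> where "\<rho> \<equiv> quotient_norm V N l"

abbreviation comb where "comb c \<equiv> \<Oplus>\<^bsub>V\<^esub>j\<in>{..<length ws}. c j \<odot>\<^bsub>V\<^esub> ws ! j"

lemma orthogonal: "orthogonal_family K \<Gamma> V l (us @ ws)"
  using basis by (simp add: orthogonal_basis_def)

lemma distinct: "distinct us" "distinct ws"
  and lists_carrier: "set us \<subseteq> carrier V" "set ws \<subseteq> carrier V"
  and gen: "span (set (us @ ws)) = carrier V"
  and zero_notin: "\<zero>\<^bsub>V\<^esub> \<notin> set (us @ ws)"
proof -
  have bas: "ordered_basis \<Lambda> V (us @ ws)" using basis by (simp add: orthogonal_basis_def)
  then show "distinct us" "distinct ws" by (auto simp: ordered_basis_def)
  have *: "LinearCombinations.module.lin_dep \<Lambda> V (set (us @ ws)) = False"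
    "set (us @ ws) \<subseteq> carrier V" "span (set (us @ ws)) = carrier V"
    using bas by (auto simp: ordered_basis_def basis_def)
  then show "span (set (us @ ws)) = carrier V" "set us \<subseteq> carrier V" "set ws \<subseteq> carrier V" by auto
  show "\<zero>\<^bsub>V\<^esub> \<notin> set (us @ ws)" using vs_zero_lin_dep[OF *(2)] *(1) by simp
qed

lemma nth_carrier: "j < length ws \<Longrightarrow> ws ! j \<in> carrier V"
  using lists_carrier(2) by (auto simp: subset_iff)

text \<open>\<open>subspace_basis\<close> refers to the span formed inside the subspace record; the
  span is the same in the ambient space.\<close>

lemma span_us: "span (set us) = N"
proof -
  interpret N: vectorspace \<Lambda> "V\<lparr>carrier := N\<rparr>"
    using subspace_is_vs submodule vectorspace by (simp add: VectorSpace.subspace_def)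
  have "set us \<subseteq> N" "N.span (set us) = N"
    using subspace_basis by (auto simp: ordered_basis_def N.basis_def)
  then show ?thesis using span_li_not_depend(1)[OF _ submodule] by metis
qed

lemma comb_closed: "(\<And>j. j < length ws \<Longrightarrow> c j \<in> carrier \<Lambda>) \<Longrightarrow> comb c \<in> carrier V"
  using nth_carrier by (intro M.finsum_closed) auto

text \<open>The infimum is attained at \<open>comb c\<close>: any other representative differs from
  it by an element of \<open>N\<close>, the span of \<open>us\<close>, and by
  \<open>orthogonal_append_minimal\<close> this cannot lower the level.\<close>

lemma quotient_norm_proj_comb:
  assumes "\<And>j. j < length ws \<Longrightarrow> c j \<in> carrier \<Lambda>"
  shows "\<rho> (proj (comb c)) = l (comb c)"
  unfolding quotient_norm_def
proof (rule antisym)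
  show "Inf {l x |x. x \<in> carrier V \<and> proj x = proj (comb c)} \<le> l (comb c)"
    using comb_closed[OF assms] by (intro Inf_lower) auto
  show "l (comb c) \<le> Inf {l x |x. x \<in> carrier V \<and> proj x = proj (comb c)}"
  proof (rule Inf_greatest, clarify)
    fix x assume "x \<in> carrier V" "proj x = proj (comb c)"
    moreover have "comb c \<in> carrier V" by (rule comb_closed[OF assms])
    ultimately obtain b where "b \<in> N" "x = b \<oplus>\<^bsub>V\<^esub> comb c" using proj_eq_iff by metis
    then show "l (comb c) \<le> l x"
      using orthogonal_append_minimal(2)[OF orthogonal distinct(1), of c b] assms span_us by simp
  qed
qed

lemma quotient_norm_proj_nth:
  assumes "j < length ws"
  shows "\<rho> (proj (ws ! j)) = l (ws ! j)"
proof -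
  \<comment> \<open>Span membership provides coefficients that express the entry as a
    \<open>comb\<close>.\<close>
  have "ws ! j \<in> span (set ws)" using assms in_own_span[OF lists_carrier(2)] by (auto simp: subset_iff)
  from in_span_nth[OF distinct(2) lists_carrier(2) this]
  obtain c where "\<And>j. j < length ws \<Longrightarrow> c j \<in> carrier \<Lambda>" "ws ! j = comb c" by blast
  then show ?thesis using quotient_norm_proj_comb[of c] by simp
qed

text \<open>Part (ii) of the theorem: the class has the representative \<open>comb c\<close> of
  minimal level, orthogonality of \<open>ws\<close> computes this level, and the scaling law turns
  each term into a norm minus a valuation.\<close>

lemma quotient_norm_comb:
  assumes c: "\<And>j. j < length ws \<Longrightarrow> c j \<in> carrier \<Lambda>"
    and \<alpha>: "\<alpha> = (\<Oplus>\<^bsub>Q\<^esub>j\<in>{..<length ws}. c j \<odot>\<^bsub>Q\<^esub> map proj ws ! j)"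
  shows "\<rho> \<alpha> = (SUP j\<in>{..<length ws}. \<rho> (map proj ws ! j) - novikov_val K (c j))"
proof -
  have "\<alpha> = proj (comb c)" using \<alpha> finsum_Q[OF lists_carrier(2), of c] c by simp
  then have "\<rho> \<alpha> = l (comb c)" using quotient_norm_proj_comb[of c] c by simp
  also have "\<dots> = (SUP j\<in>{..<length ws}. l (c j \<odot>\<^bsub>V\<^esub> ws ! j))"
    \<comment> \<open>The zero vector meets the span premise.\<close>
    using orthogonal_append_minimal(1)[OF orthogonal distinct(1), of c "\<zero>\<^bsub>V\<^esub>"] c span_zero by simp
  also have "\<dots> = (SUP j\<in>{..<length ws}. \<rho> (map proj ws ! j) - novikov_val K (c j))"
    by (intro SUP_cong) (simp_all add: quotient_norm_proj_nth smult c nth_carrier)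
  finally show ?thesis .
qed

lemma quotient_norm_zero: "\<rho> \<zero>\<^bsub>Q\<^esub> = - \<infinity>"
proof -
  have "\<rho> \<zero>\<^bsub>Q\<^esub> \<le> l \<zero>\<^bsub>V\<^esub>"
    unfolding quotient_norm_def zero_Q by (intro Inf_lower) auto
  then show ?thesis by (simp add: norm_zero)
qed

lemma norm_finite:
  assumes "x \<in> set (us @ ws)"
  shows "l x \<noteq> - \<infinity>" "l x \<noteq> \<infinity>"
proof -
  have "x \<noteq> \<zero>\<^bsub>V\<^esub>" using zero_notin assms by metis
  moreover have "x \<in> carrier V" using assms lists_carrier by auto
  ultimately show "l x \<noteq> - \<infinity>" "l x \<noteq> \<infinity>" using eq_MInf_iff not_PInf by auto
qed

lemma nth_norm_finite:
  assumes "j < length ws"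
  shows "l (ws ! j) \<noteq> - \<infinity>" "l (ws ! j) \<noteq> \<infinity>"
  using norm_finite[of "ws ! j"] assms by simp_all

text \<open>Independence follows from the norm formula: in a relation every term is bounded by the
  norm of zero, which is \<open>- \<infinity>\<close>, while a nonzero coefficient has finite
  valuation and so gives a finite term.\<close>

lemma indpt_Q:
  assumes c: "\<And>j. j < length ws \<Longrightarrow> c j \<in> carrier \<Lambda>"
    and zero: "(\<Oplus>\<^bsub>Q\<^esub>j\<in>{..<length ws}. c j \<odot>\<^bsub>Q\<^esub> map proj ws ! j) = \<zero>\<^bsub>Q\<^esub>"
    and j: "j < length ws"
  shows "c j = \<zero>\<^bsub>\<Lambda>\<^esub>"
proof (rule ccontr)
  assume "c j \<noteq> \<zero>\<^bsub>\<Lambda>\<^esub>"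
  then obtain g where g: "novikov_val K (c j) = ereal g" using novikov_val_in[OF c[OF j]] by metis
  have "\<rho> (map proj ws ! j) - novikov_val K (c j) \<le> \<rho> \<zero>\<^bsub>Q\<^esub>"
    by (subst quotient_norm_comb[OF c zero[symmetric]]) (use j in \<open>auto intro: SUP_upper\<close>)
  then have "l (ws ! j) - ereal g = - \<infinity>" using j g by (simp add: quotient_norm_proj_nth quotient_norm_zero)
  then show False using nth_norm_finite[OF j] by (cases "l (ws ! j)") auto
qed

text \<open>A representative splits into a part in the span of \<open>us\<close>, which is
  \<open>N\<close> and dies in the quotient, and a part in the span of \<open>ws\<close>.\<close>

lemma gen_Q:
  assumes "\<alpha> \<in> carrier Q"
  obtains c where "\<And>j. j < length ws \<Longrightarrow> c j \<in> carrier \<Lambda>"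
    and "\<alpha> = (\<Oplus>\<^bsub>Q\<^esub>j\<in>{..<length ws}. c j \<odot>\<^bsub>Q\<^esub> map proj ws ! j)"
proof -
  obtain x where x: "x \<in> carrier V" "\<alpha> = proj x" using assms by (rule carrier_QE)
  have "x \<in> subspace_sum (span (set us)) (span (set ws))"
    using x(1) gen span_union_is_sum[OF lists_carrier] by simp
  then obtain b y where b: "b \<in> N" and y: "y \<in> span (set ws)" and xby: "x = b \<oplus>\<^bsub>V\<^esub> y"
    by (auto simp: submodule_sum_def span_us)
  from in_span_nth[OF distinct(2) lists_carrier(2) y]
  obtain c where c: "\<And>j. j < length ws \<Longrightarrow> c j \<in> carrier \<Lambda>" and yc: "y = comb c" by blast
  have "y \<in> carrier V" unfolding yc by (rule comb_closed[OF c])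
  then have "\<alpha> = proj y" using x b xby proj_eq_iff by metis
  also have "\<dots> = (\<Oplus>\<^bsub>Q\<^esub>j\<in>{..<length ws}. c j \<odot>\<^bsub>Q\<^esub> map proj ws ! j)"
    unfolding yc by (rule finsum_Q[OF lists_carrier(2) c, symmetric])
  finally show ?thesis using that[of c] c by simp
qed

lemma ordered_basis_Q: "ordered_basis \<Lambda> Q (map proj ws)"
proof (rule vectorspace.ordered_basisI[OF quotient_vectorspace])
  show "set (map proj ws) \<subseteq> carrier Q" using lists_carrier(2) proj_in_Q by auto
  show "c j = \<zero>\<^bsub>\<Lambda>\<^esub>" if "\<And>i. i < length (map proj ws) \<Longrightarrow> c i \<in> carrier \<Lambda>"
    "(\<Oplus>\<^bsub>Q\<^esub>i\<in>{..<length (map proj ws)}. c i \<odot>\<^bsub>Q\<^esub> map proj ws ! i) = \<zero>\<^bsub>Q\<^esub>"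
    "j < length (map proj ws)" for c j
    using that by (intro indpt_Q) simp_all
  show "\<exists>c. (\<forall>i<length (map proj ws). c i \<in> carrier \<Lambda>) \<and>
      v = (\<Oplus>\<^bsub>Q\<^esub>i\<in>{..<length (map proj ws)}. c i \<odot>\<^bsub>Q\<^esub> map proj ws ! i)"
    if "v \<in> carrier Q" for v
    using gen_Q[OF that] unfolding length_map by blast
qed

text \<open>The maximum in the norm formula is attained at some \<open>j\<close>. As the class is
  nonzero this maximum is finite, so the coefficient at \<open>j\<close> is nonzero and its
  valuation, an element of \<Gamma>, disappears in the residue.\<close>

lemma real_mod_quotient_norm:
  assumes \<Gamma>: "subgroup \<Gamma> real_add_group" and \<alpha>: "\<alpha> \<in> carrier Q" "\<alpha> \<noteq> \<zero>\<^bsub>Q\<^esub>"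
  obtains x where "x \<in> set ws" and "real_mod \<Gamma> (\<rho> \<alpha>) = real_mod \<Gamma> (l x)"
proof -
  obtain c where c: "\<And>j. j < length ws \<Longrightarrow> c j \<in> carrier \<Lambda>"
    and eq: "\<alpha> = (\<Oplus>\<^bsub>Q\<^esub>j\<in>{..<length ws}. c j \<odot>\<^bsub>Q\<^esub> map proj ws ! j)"
    using gen_Q[OF \<alpha>(1)] by blast
  interpret Q: vectorspace \<Lambda> Q by (rule quotient_vectorspace)
  let ?f = "\<lambda>j. \<rho> (map proj ws ! j) - novikov_val K (c j)"
  \<comment> \<open>This index serves twice: it makes the index set nonempty, so that the supremum
    is a maximum, and its term is a finite lower bound for the norm.\<close>
  obtain i where i: "i < length ws" "c i \<noteq> \<zero>\<^bsub>\<Lambda>\<^esub>"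
  proof (rule ccontr)
    assume "\<not> thesis"
    then have "c j = \<zero>\<^bsub>\<Lambda>\<^esub>" if "j < length ws" for j using \<open>\<And>i. _ i \<Longrightarrow> _ i \<Longrightarrow> thesis\<close> that by blast
    then have "\<alpha> = \<zero>\<^bsub>Q\<^esub>" unfolding eq
      using nth_carrier proj_in_Q by (intro Q.M.add.finprod_one_eqI) auto
    then show False using \<alpha>(2) by simp
  qed
  have "\<rho> \<alpha> = Sup (?f ` {..<length ws})" by (rule quotient_norm_comb[OF c eq])
  also have "\<dots> = Max (?f ` {..<length ws})" using i by (subst Max_Sup) auto
  also have "\<dots> \<in> ?f ` {..<length ws}" using i by (intro Max_in) auto
  finally obtain j where j: "j < length ws" "\<rho> \<alpha> = ?f j" by auto
  have "\<rho> \<alpha> \<noteq> - \<infinity>"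
  proof
    assume "\<rho> \<alpha> = - \<infinity>"
    moreover have "?f i \<le> \<rho> \<alpha>"
      by (subst quotient_norm_comb[OF c eq]) (use i in \<open>auto intro: SUP_upper\<close>)
    moreover obtain g where "novikov_val K (c i) = ereal g"
      using novikov_val_in[OF c[OF i(1)] i(2)] by metis
    ultimately show False
      using nth_norm_finite[OF i(1)] i(1) by (cases "l (ws ! i)") (auto simp: quotient_norm_proj_nth)
  qed
  \<comment> \<open>A zero coefficient has valuation \<open>\<infinity>\<close>, so its term would
    be \<open>- \<infinity>\<close>.\<close>
  then have "c j \<noteq> \<zero>\<^bsub>\<Lambda>\<^esub>"
    using j nth_norm_finite[OF j(1)]
    by (cases "l (ws ! j)") (auto simp: quotient_norm_proj_nth novikov_val_def novikov_field_def)
  then obtain g where g: "g \<in> \<Gamma>" "novikov_val K (c j) = ereal g"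
    using novikov_val_in[OF c[OF j(1)]] by metis
  then have "real_mod \<Gamma> (\<rho> \<alpha>) = real_mod \<Gamma> (l (ws ! j))"
    using real_mod_diff[OF \<Gamma> g(1)] j by (simp add: quotient_norm_proj_nth)
  then show ?thesis using that j(1) nth_mem by blast
qed

end

theorem proposition6p6:
  fixes K :: "('k, 'm) ring_scheme" and \<Gamma> :: "real set"
    and C :: "int \<Rightarrow> (real \<Rightarrow> 'k, 'c, 'n) module_scheme"
    and d :: "int \<Rightarrow> 'c \<Rightarrow> 'c" and l :: "int \<Rightarrow> 'c \<Rightarrow> ereal"
    and k :: int and B :: "(real set \<times> ereal) multiset"
  assumes "field K" and "subgroup \<Gamma> real_add_group"
    and "floer_type_complex K \<Gamma> C d l"
    and "concise_barcode K \<Gamma> C d l k B"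
  shows "let \<Lambda> = novikov_field K \<Gamma>; H = homology C d k; \<rho> = spectral_invariant C d l k in
    \<exists>\<alpha>s. ordered_basis \<Lambda> H \<alpha>s \<and>
      filter_mset (\<lambda>b. snd b = \<infinity>) B = mset (map (\<lambda>\<alpha>. (real_mod \<Gamma> (\<rho> \<alpha>), \<infinity>)) \<alpha>s) \<and>
      (\<forall>\<alpha>\<in>carrier H.
         (\<forall>c. (\<forall>i<length \<alpha>s. c i \<in> carrier \<Lambda>) \<and>
              \<alpha> = (\<Oplus>\<^bsub>H\<^esub>i\<in>{..<length \<alpha>s}. c i \<odot>\<^bsub>H\<^esub> \<alpha>s ! i) \<longrightarrow>
            \<rho> \<alpha> = (SUP i\<in>{..<length \<alpha>s}. \<rho> (\<alpha>s ! i) - novikov_val K (c i))) \<and>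
         (\<alpha> \<noteq> \<zero>\<^bsub>H\<^esub> \<longrightarrow> (real_mod \<Gamma> (\<rho> \<alpha>), \<infinity>) \<in># B))"
proof -

  \<comment> \<open>Cycles, boundaries and the differential between them\<close>
  interpret floer_type_complex K \<Gamma> C d l by (rule assms(3))
  define \<Lambda> where "\<Lambda> = novikov_field K \<Gamma>"
  define Z where "Z = cycle_space C d k"
  define N where "N = boundaries C d k"
  define D where "D = d (k + 1)"
  have normed: "nonarch_normed_space K \<Gamma> (C j) (l j)" and fin: "vectorspace.fin_dim \<Lambda> (C j)" for j
    using orthogonalizable[of j] by (auto simp: orthogonalizable_def \<Lambda>_def)
  have vec: "vectorspace \<Lambda> (C j)" for j
    using nonarch_normed_space.vectorspace[OF normed] by (simp add: \<Lambda>_def)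
  then have mod: "Module.module \<Lambda> (C j)" for j by (simp add: vectorspace_def)
  interpret dk: mod_hom \<Lambda> "C k" "C (k - 1)" "d k"
    using mod differential[of k] by (simp add: mod_hom_def mod_hom_axioms_def \<Lambda>_def)
  have Z: "Z = (C k)\<lparr>carrier := dk.ker\<rparr>" by (simp add: Z_def cycle_space_def kernel_space_def)
  have Z_car: "carrier Z = {x \<in> carrier (C k). d k x = \<zero>\<^bsub>C (k - 1)\<^esub>}" by (simp add: Z dk.ker_def)
  have normed_Z: "nonarch_normed_space K \<Gamma> Z (l k)"
    unfolding Z using dk.ker_is_submodule
    by (intro nonarch_normed_space.nonarch_normed_subspace[OF normed]) (simp add: \<Lambda>_def)
  have vec_Z: "vectorspace \<Lambda> Z"
    using nonarch_normed_space.vectorspace[OF normed_Z] by (simp add: \<Lambda>_def)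
  have D_hom: "D \<in> LinearCombinations.module_hom \<Lambda> (C (k + 1)) (C k)"
    using differential[of "k + 1"] by (simp add: D_def \<Lambda>_def)
  \<comment> \<open>Since the differential squares to zero, \<open>D\<close> takes values in the
    cycles. As \<open>Z\<close> keeps the operations of \<open>C k\<close>, it is then a linear map
    into \<open>Z\<close>.\<close>
  have "D x \<in> carrier Z" if "x \<in> carrier (C (k + 1))" for x
    using differential_square[OF that] module_hom_closed[OF D_hom] that by (auto simp: Z_car D_def)
  then have "D \<in> LinearCombinations.module_hom \<Lambda> (C (k + 1)) Z"
    using D_hom by (simp add: LinearCombinations.module_hom_def Z)
  then interpret D: linear_map \<Lambda> "C (k + 1)" Z D
    using vec[of "k + 1"] vec_Z
    by (simp add: linear_map_def mod_hom_def mod_hom_axioms_def vectorspace_def)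
  have N: "N = D.im" by (simp add: N_def boundaries_def D_def)

  \<comment> \<open>The singular value decomposition, homology and the infinite bars\<close>
  define r where "r = map_rank \<Lambda> (C (k + 1)) Z D"
  obtain ys xs where svd: "singular_value_decomposition K \<Gamma> (C (k + 1)) (l (k + 1)) Z (l k) D ys xs"
    and B: "B = mset [(real_mod \<Gamma> (l k (xs ! i)), l (k + 1) (ys ! i) - l k (xs ! i)).
                       i \<leftarrow> [0..<r], l k (xs ! i) < l (k + 1) (ys ! i)]
             + mset [(real_mod \<Gamma> (l k x), \<infinity>). x \<leftarrow> drop r xs]"
    using assms(4) by (auto simp: concise_barcode_def Let_def r_def \<Lambda>_def Z_def D_def)
  define us ws where "us = take r xs" and "ws = drop r xs"
  have xs: "xs = us @ ws" by (simp add: us_def ws_def)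
  have im: "image_space (C (k + 1)) Z D = Z\<lparr>carrier := N\<rparr>" by (simp add: image_space_def N)
  have bases: "orthogonal_basis K \<Gamma> (C (k + 1)) (l (k + 1)) ys"
    "orthogonal_basis K \<Gamma> Z (l k) (us @ ws)" "ordered_basis \<Lambda> (Z\<lparr>carrier := N\<rparr>) us"
    using svd by (simp_all add: singular_value_decomposition_def Let_def us_def ws_def im r_def \<Lambda>_def
        orthogonal_basis_def)
  have rank: "r = vectorspace.dim \<Lambda> (Z\<lparr>carrier := N\<rparr>)" by (simp add: r_def map_rank_def im)
  interpret N: vectorspace \<Lambda> "Z\<lparr>carrier := N\<rparr>"
    unfolding N by (rule D.W.subspace_is_vs[OF D.imT_is_subspace])
  \<comment> \<open>List access by position is total, so \<open>r\<close> must be compared with both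
    lengths before \<open>xs ! i\<close> and \<open>ys ! i\<close> with \<open>i < r\<close> count
    as basis vectors. Here \<open>us\<close> is a basis of the image, of dimension \<open>r\<close>;
    for \<open>ys\<close> the bound comes from rank-nullity.\<close>
  have "length us = r"
    using bases(3) N.dim_basis[of "set us"] by (auto simp: ordered_basis_def rank distinct_card)
  then have r_xs: "r \<le> length xs" by (simp add: xs)
  have "r \<le> D.V.dim" using D.rank_nullity[OF fin] by (simp add: rank N)
  also have "D.V.dim = length ys"
    using bases(1) D.V.dim_basis[of "set ys"]
    by (auto simp: orthogonal_basis_def ordered_basis_def distinct_card \<Lambda>_def)
  finally have r_ys: "r \<le> length ys" .
  interpret Q: orthogonal_quotient K \<Gamma> Z "l k" N us ws
    unfolding orthogonal_quotient_def orthogonal_quotient_axioms_def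
    using normed_Z D.im_is_submodule bases(2,3) by (simp add: N \<Lambda>_def)
  have H: "homology C d k = Q.Q" by (simp add: homology_def Z_def N_def)
  \<comment> \<open>The conditions of being a chain and being closed together say membership in the
    carrier of \<open>Z\<close>, so the two infima range over the same set.\<close>
  have \<rho>: "spectral_invariant C d l k = Q.\<rho>"
    by (rule ext) (simp add: spectral_invariant_def quotient_norm_def Z_car conj_assoc flip: Z_def N_def)
  \<comment> \<open>The upper level is not \<open>\<infinity>\<close> and the lower one is not
    \<open>- \<infinity>\<close>, the latter because \<open>xs ! i\<close> is a basis vector. Hence
    no bar from the first \<open>r\<close> positions passes the filter for infinite bars, and
    exactly those of \<open>ws\<close> remain.\<close>
  have finite_bar: "l (k + 1) (ys ! i) - l k (xs ! i) \<noteq> \<infinity>" if "i < r" for i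
  proof -
    have "set ys \<subseteq> carrier (C (k + 1))"
      using bases(1) by (simp add: orthogonal_basis_def orthogonal_family_def)
    then have "ys ! i \<in> carrier (C (k + 1))" using that r_ys by auto
    then have "l (k + 1) (ys ! i) \<noteq> \<infinity>" by (rule nonarch_normed_space.not_PInf[OF normed])
    moreover have "l k (xs ! i) \<noteq> - \<infinity>" using that r_xs by (intro Q.norm_finite) (simp flip: xs)
    ultimately show ?thesis by (cases "l (k + 1) (ys ! i)"; cases "l k (xs ! i)") auto
  qed
  have B_inf: "filter_mset (\<lambda>b. snd b = \<infinity>) B = mset [(real_mod \<Gamma> (l k x), \<infinity>). x \<leftarrow> ws]"
  proof -
    have "filter_mset (\<lambda>b. snd b = \<infinity>) (mset [(real_mod \<Gamma> (l k (xs ! i)), l (k + 1) (ys ! i) - l k (xs ! i)).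
        i \<leftarrow> [0..<r], l k (xs ! i) < l (k + 1) (ys ! i)]) = {#}"
      using finite_bar by auto
    moreover have "filter_mset (\<lambda>b. snd b = \<infinity>) (mset [(real_mod \<Gamma> (l k x), \<infinity>). x \<leftarrow> ws]) =
        mset [(real_mod \<Gamma> (l k x), \<infinity>). x \<leftarrow> ws]"
      by (auto simp: filter_mset_eq_conv)
    ultimately show ?thesis
      unfolding B ws_def[symmetric] by (simp only: filter_union_mset add_0)
  qed
  have norms: "map (\<lambda>\<alpha>. (real_mod \<Gamma> (Q.\<rho> \<alpha>), \<infinity>)) (map Q.proj ws) =
      [(real_mod \<Gamma> (l k x), \<infinity>). x \<leftarrow> ws]"
    by (rule nth_equalityI) (simp_all add: Q.quotient_norm_proj_nth)
  show ?thesis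
    unfolding Let_def H \<rho>
  proof (intro exI[of _ "map Q.proj ws"] conjI ballI allI impI)
    show "ordered_basis (novikov_field K \<Gamma>) Q.Q (map Q.proj ws)" by (rule Q.ordered_basis_Q)
    show "filter_mset (\<lambda>b. snd b = \<infinity>) B =
        mset (map (\<lambda>\<alpha>. (real_mod \<Gamma> (Q.\<rho> \<alpha>), \<infinity>)) (map Q.proj ws))"
      unfolding norms by (rule B_inf)
  next
    fix \<alpha> c
    assume "(\<forall>i<length (map Q.proj ws). c i \<in> carrier (novikov_field K \<Gamma>)) \<and>
      \<alpha> = (\<Oplus>\<^bsub>Q.Q\<^esub>i\<in>{..<length (map Q.proj ws)}. c i \<odot>\<^bsub>Q.Q\<^esub> map Q.proj ws ! i)"
    then show "Q.\<rho> \<alpha> = (SUP i\<in>{..<length (map Q.proj ws)}. Q.\<rho> (map Q.proj ws ! i) - novikov_val K (c i))"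
      unfolding length_map by (intro Q.quotient_norm_comb) blast+
  next
    fix \<alpha> assume "\<alpha> \<in> carrier Q.Q" "\<alpha> \<noteq> \<zero>\<^bsub>Q.Q\<^esub>"
    then obtain x where "x \<in> set ws" "real_mod \<Gamma> (Q.\<rho> \<alpha>) = real_mod \<Gamma> (l k x)"
      by (rule Q.real_mod_quotient_norm[OF assms(2)])
    then have "(real_mod \<Gamma> (Q.\<rho> \<alpha>), \<infinity>) \<in># filter_mset (\<lambda>b. snd b = \<infinity>) B"
      unfolding B_inf by auto
    then show "(real_mod \<Gamma> (Q.\<rho> \<alpha>), \<infinity>) \<in># B" by simp
  qed
qed

end
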